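(* Let $k=\mathbb{F}_q$, let $Q$ be a finite quiver, let $A=kQ/I$ be a basic algebra presented by $Q$ with relations, let $\mu$ be a slope function and let $\alpha$ be a nonzero dimension vector. Then $$|\mathrm{Rep}_\alpha^\mu(A)|=\sum (-1)^{s-1}\,|\mathrm{Frep}_{\alpha_1\cdots\alpha_s}(A)|,$$ where the sum runs over all $s\ge 1$ and all decompositions $\alpha_1+\cdots+\alpha_s=\alpha$ of $\alpha$ into (ordered) nonzero dimension vectors such that $\mu\bigl(\sum_{l=1}^{j}\alpha_l\bigr)<\mu(\alpha)$ for all $j<s$. Here $|\cdot|$ denotes the number of $\mathbb{F}_q$-rational points.
   Context: Let $Q$ have vertex set $Q_0$ and arrow set $Q_1$; $ta,ha$ are the tail and head of an arrow $a$. A dimension vector is an element of $\mathbb{Z}_{\ge 0}^{Q_0}$. $\mathrm{Rep}_\alpha(Q)=\bigoplus_{a\in Q_1}\mathrm{Hom}(k^{\alpha(ta)},k^{\alpha(ha)})$, and $\mathrm{Rep}_\alpha(A)\subseteq \mathrm{Rep}_\alpha(Q)$ is the variety of $\alpha$-dimensional representations satisfying the relations of $A$. A weight is an integral linear functional on $\mathbb{Z}^{Q_0}$; a slope function is a quotient $\mu=\sigma/\theta$ of two weights with $\theta(\alpha)>0$ for every nonzero dimension vector $\alpha$. A representation $M$ is $\mu$-semistable if $\mu(\underline{\dim} L)\le \mu(\underline{\dim} M)$ for every nonzero subrepresentation $L\subseteq M$. $\mathrm{Rep}_\alpha^\mu(A)$ is the variety of $\mu$-semistable representations in $\mathrm{Rep}_\alpha(A)$.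 For a decomposition $\alpha=\alpha_1+\cdots+\alpha_s$, $\mathrm{Frep}_{\alpha_1\cdots\alpha_s}(A)$ is the variety of tuples $(M,L_1,\dots,L_{s-1})$ where $M\in\mathrm{Rep}_\alpha(A)$ and $0=L_0\subset L_1\subset\cdots\subset L_{s-1}\subset L_s=M$ is a chain of subrepresentations of $M$ (given by $Q_0$-graded subspaces of $\bigoplus_v k^{\alpha(v)}$) with $\underline{\dim}(L_i/L_{i-1})=\alpha_{s+1-i}$. So the rightmost index $\alpha_s$ is the dimension vector of the smallest subrepresentation $L_1$, and the leftmost index $\alpha_1$ is the dimension vector of the top quotient $M/L_{s-1}$. For $s=1$ it is $\mathrm{Rep}_\alpha(A)$. *)

theory Defs
  imports
    "Graph_Theory.Digraph"
    "Graph_Theory.Arc_Walk"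
    "Jordan_Normal_Form.VS_Connect"
    "HOL-Algebra.Ideal"
    "HOL-Library.Poly_Mapping"
    "HOL-Library.Function_Algebras"
begin

section \<open>The path algebra of a quiver\<close>

text \<open>
  A finite quiver is a \<^locale>\<open>fin_digraph\<close>, in which loops and multiple arrows are allowed.
  A path is a pair of its source and the list of its arrows in the order in which they are
  traversed; the source is recorded because of the trivial paths \<open>(v, [])\<close>.
\<close>

type_synonym ('v, 'e) path = "'v \<times> 'e list"

definition paths :: "('v, 'e) pre_digraph \<Rightarrow> ('v, 'e) path set" where
  "paths Q = {(u, p). \<exists>v. pre_digraph.awalk Q u p v}"

definition path_source :: "('v, 'e) path \<Rightarrow> 'v" where
  "path_source \<pi> = fst \<pi>"

definition path_target :: "('v, 'e) pre_digraph \<Rightarrow> ('v, 'e) path \<Rightarrow> 'v" where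
  "path_target Q \<pi> = last (pre_digraph.awalk_verts Q (fst \<pi>) (snd \<pi>))"

text \<open>
  Paths are composed like maps: \<open>\<pi> \<cdot> \<rho>\<close> is \<open>\<rho>\<close> followed by \<open>\<pi>\<close>, and \<open>0\<close> if the
  target of \<open>\<rho>\<close> is not the source of \<open>\<pi>\<close>. Below, \<open>path_mult Q \<pi> \<rho> c\<close> is
  \<open>c\<close> times this product.
\<close>

definition path_mult ::
  "('v, 'e) pre_digraph \<Rightarrow> ('v, 'e) path \<Rightarrow> ('v, 'e) path \<Rightarrow> 'k \<Rightarrow> ('v, 'e) path \<Rightarrow>\<^sub>0 'k::field" where
  "path_mult Q \<pi> \<rho> c =
     (if path_source \<pi> = path_target Q \<rho>
      then Poly_Mapping.single (fst \<rho>, snd \<rho> @ snd \<pi>) c else 0)"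

definition path_algebra :: "('v, 'e) pre_digraph \<Rightarrow> (('v, 'e) path \<Rightarrow>\<^sub>0 'k::field) ring" where
  "path_algebra Q =
     \<lparr>carrier = {f. Poly_Mapping.keys f \<subseteq> paths Q},
      monoid.mult = (\<lambda>f g. \<Sum>\<pi>\<in>Poly_Mapping.keys f. \<Sum>\<rho>\<in>Poly_Mapping.keys g.
        path_mult Q \<pi> \<rho> (Poly_Mapping.lookup f \<pi> * Poly_Mapping.lookup g \<rho>)),
      one = (\<Sum>v\<in>verts Q. Poly_Mapping.single (v, []) 1),
      zero = 0,
      add = (+)\<rparr>"


subsection \<open>The path algebra is a ring\<close>

lemma path_mult_0 [simp]: "path_mult Q \<pi> \<rho> 0 = 0"
  by (simp add: path_mult_def)

lemma path_mult_add: "path_mult Q \<pi> \<rho> (c + d) = path_mult Q \<pi> \<rho> c + path_mult Q \<pi> \<rho> d"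
  by (simp add: path_mult_def single_add)

lemma path_algebra_mult_eq:
  assumes "finite A" "Poly_Mapping.keys f \<subseteq> A" "finite B" "Poly_Mapping.keys g \<subseteq> B"
  shows "f \<otimes>\<^bsub>path_algebra Q\<^esub> g = (\<Sum>\<pi>\<in>A. \<Sum>\<rho>\<in>B.
    path_mult Q \<pi> \<rho> (Poly_Mapping.lookup f \<pi> * Poly_Mapping.lookup g \<rho>))"
proof -
  have 1: "(\<Sum>\<rho>\<in>Poly_Mapping.keys g.
        path_mult Q \<pi> \<rho> (Poly_Mapping.lookup f \<pi> * Poly_Mapping.lookup g \<rho>)) =
      (\<Sum>\<rho>\<in>B. path_mult Q \<pi> \<rho> (Poly_Mapping.lookup f \<pi> * Poly_Mapping.lookup g \<rho>))" for \<pi>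
    by (rule sum.mono_neutral_left) (use assms in \<open>auto simp: in_keys_iff\<close>)
  show ?thesis
    unfolding path_algebra_def monoid.simps 1
    by (rule sum.mono_neutral_left) (use assms in \<open>auto simp: in_keys_iff\<close>)
qed

lemma path_algebra_l_distr:
  "(f + f') \<otimes>\<^bsub>path_algebra Q\<^esub> g = f \<otimes>\<^bsub>path_algebra Q\<^esub> g + f' \<otimes>\<^bsub>path_algebra Q\<^esub> g"
proof -
  let ?A = "Poly_Mapping.keys f \<union> Poly_Mapping.keys f' \<union> Poly_Mapping.keys (f + f')"
  have "finite ?A" by simp
  then show ?thesis
    by (subst (1 2 3) path_algebra_mult_eq[where A = ?A and B = "Poly_Mapping.keys g"])
      (auto simp: lookup_add distrib_right path_mult_add sum.distrib)
qed

lemma path_algebra_r_distr: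
  "g \<otimes>\<^bsub>path_algebra Q\<^esub> (f + f') = g \<otimes>\<^bsub>path_algebra Q\<^esub> f + g \<otimes>\<^bsub>path_algebra Q\<^esub> f'"
proof -
  let ?A = "Poly_Mapping.keys f \<union> Poly_Mapping.keys f' \<union> Poly_Mapping.keys (f + f')"
  have "finite ?A" by simp
  then show ?thesis
    by (subst (1 2 3) path_algebra_mult_eq[where B = ?A and A = "Poly_Mapping.keys g"])
      (auto simp: lookup_add distrib_left path_mult_add sum.distrib)
qed

lemma path_algebra_mult_0 [simp]:
  "0 \<otimes>\<^bsub>path_algebra Q\<^esub> g = 0" "g \<otimes>\<^bsub>path_algebra Q\<^esub> 0 = 0"
  by (simp_all add: path_algebra_def)

lemma path_algebra_mult_single:
  "Poly_Mapping.single \<pi> c \<otimes>\<^bsub>path_algebra Q\<^esub> Poly_Mapping.single \<rho> d = path_mult Q \<pi> \<rho> (c * d)"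
  by (subst path_algebra_mult_eq[where A = "{\<pi>}" and B = "{\<rho>}"]) auto

lemma path_target_append:
  "path_target Q (u, p @ q) = path_target Q (path_target Q (u, p), q)"
  by (simp add: path_target_def pre_digraph.awalk_verts_conv)

lemma poly_mapping_sum_singles:
  fixes f :: "'x \<Rightarrow>\<^sub>0 'k::comm_monoid_add"
  shows "(\<Sum>x\<in>Poly_Mapping.keys f. Poly_Mapping.single x (Poly_Mapping.lookup f x)) = f"
proof (rule poly_mapping_eqI)
  fix y
  have "Poly_Mapping.lookup (\<Sum>x\<in>X. Poly_Mapping.single x (c x)) y = (\<Sum>x\<in>X. c x when x = y)"
    if "finite X" for X and c :: "'x \<Rightarrow> 'k"
    using that by induction (auto simp: lookup_add lookup_single)
  then show "Poly_Mapping.lookup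
      (\<Sum>x\<in>Poly_Mapping.keys f. Poly_Mapping.single x (Poly_Mapping.lookup f x)) y
      = Poly_Mapping.lookup f y"
    by (simp add: when_def sum.delta in_keys_iff)
qed

lemma poly_mapping_single_induct:
  fixes P :: "('x \<Rightarrow>\<^sub>0 'k::comm_monoid_add) \<Rightarrow> bool"
  assumes "P 0" "\<And>x c. P (Poly_Mapping.single x c)" "\<And>f g. P f \<Longrightarrow> P g \<Longrightarrow> P (f + g)"
  shows "P f"
proof -
  have "P (\<Sum>x\<in>X. Poly_Mapping.single x (c x))" if "finite X" for X and c :: "'x \<Rightarrow> 'k"
    using that by induction (use assms in auto)
  from this[OF finite_keys] show ?thesis
    by (metis poly_mapping_sum_singles)
qed

lemma path_algebra_assoc:
  "(f \<otimes>\<^bsub>path_algebra Q\<^esub> g) \<otimes>\<^bsub>path_algebra Q\<^esub> h = f \<otimes>\<^bsub>path_algebra Q\<^esub> (g \<otimes>\<^bsub>path_algebra Q\<^esub> h)"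
proof -
  have s: "(Poly_Mapping.single \<pi> a \<otimes>\<^bsub>path_algebra Q\<^esub> Poly_Mapping.single \<rho> b)
      \<otimes>\<^bsub>path_algebra Q\<^esub> Poly_Mapping.single \<sigma> c
    = Poly_Mapping.single \<pi> a \<otimes>\<^bsub>path_algebra Q\<^esub>
      (Poly_Mapping.single \<rho> b \<otimes>\<^bsub>path_algebra Q\<^esub> Poly_Mapping.single \<sigma> c)"
    for \<pi> \<rho> \<sigma> :: "('a, 'b) path" and a b c :: 'c
  proof (cases \<rho>, cases \<sigma>)
    fix u p v q assume [simp]: "\<rho> = (u, p)" "\<sigma> = (v, q)"
    show ?thesis
      unfolding path_algebra_mult_single
      by (auto simp: path_mult_def path_algebra_mult_single path_source_def path_target_append
          mult.assoc)
  qed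
  have 1: "(Poly_Mapping.single \<pi> a \<otimes>\<^bsub>path_algebra Q\<^esub> Poly_Mapping.single \<rho> b)
      \<otimes>\<^bsub>path_algebra Q\<^esub> h
    = Poly_Mapping.single \<pi> a \<otimes>\<^bsub>path_algebra Q\<^esub>
      (Poly_Mapping.single \<rho> b \<otimes>\<^bsub>path_algebra Q\<^esub> h)" for \<pi> \<rho> a b
    by (induction h rule: poly_mapping_single_induct) (simp_all add: s path_algebra_r_distr)
  have 2: "(Poly_Mapping.single \<pi> a \<otimes>\<^bsub>path_algebra Q\<^esub> g) \<otimes>\<^bsub>path_algebra Q\<^esub> h
    = Poly_Mapping.single \<pi> a \<otimes>\<^bsub>path_algebra Q\<^esub> (g \<otimes>\<^bsub>path_algebra Q\<^esub> h)" for \<pi> a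
    by (induction g rule: poly_mapping_single_induct)
      (simp_all add: 1 path_algebra_r_distr path_algebra_l_distr)
  show ?thesis
    by (induction f rule: poly_mapping_single_induct) (simp_all add: 2 path_algebra_l_distr)
qed

lemma (in fin_digraph) path_mult_closed:
  assumes "\<pi> \<in> paths G" "\<rho> \<in> paths G"
  shows "Poly_Mapping.keys (path_mult G \<pi> \<rho> c) \<subseteq> paths G"
proof (cases \<pi>, cases \<rho>)
  fix u p v q assume [simp]: "\<pi> = (u, p)" "\<rho> = (v, q)"
  show ?thesis
    using assms
    by (auto simp: path_mult_def path_source_def path_target_def paths_def keys_def when_def
        lookup_single split: if_splits intro: awalk_appendI)
qed

lemma keys_sum_subset:
  assumes "\<And>x. x \<in> A \<Longrightarrow> Poly_Mapping.keys (f x) \<subseteq> B"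
  shows "Poly_Mapping.keys (\<Sum>x\<in>A. f x) \<subseteq> B"
  using assms
  by (induction A rule: infinite_finite_induct) (use keys_add in \<open>fastforce+\<close>)

lemma path_algebra_carrier:
  "f \<in> carrier (path_algebra Q) \<longleftrightarrow> Poly_Mapping.keys f \<subseteq> paths Q"
  by (simp add: path_algebra_def)

lemma (in fin_digraph) path_algebra_closed:
  assumes "f \<in> carrier (path_algebra G)" "g \<in> carrier (path_algebra G)"
  shows "f \<otimes>\<^bsub>path_algebra G\<^esub> g \<in> carrier (path_algebra G)"
  using assms unfolding path_algebra_carrier
  unfolding path_algebra_def monoid.simps
  by (intro keys_sum_subset path_mult_closed) blast+

lemma (in fin_digraph) path_algebra_one:
  assumes "f \<in> carrier (path_algebra G)"
  shows "\<one>\<^bsub>path_algebra G\<^esub> \<otimes>\<^bsub>path_algebra G\<^esub> f = f"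
    and "f \<otimes>\<^bsub>path_algebra G\<^esub> \<one>\<^bsub>path_algebra G\<^esub> = f"
proof -
  have one: "\<one>\<^bsub>path_algebra G\<^esub> = (\<Sum>v\<in>verts G. Poly_Mapping.single (v, []) 1)"
    by (simp add: path_algebra_def)
  have suml: "(\<Sum>v\<in>V. h v) \<otimes>\<^bsub>path_algebra G\<^esub> g = (\<Sum>v\<in>V. h v \<otimes>\<^bsub>path_algebra G\<^esub> g)"
    if "finite V" for V and h :: "'a \<Rightarrow> ('a, 'b) path \<Rightarrow>\<^sub>0 'c" and g
    using that by induction (simp_all add: path_algebra_l_distr)
  have sumr: "g \<otimes>\<^bsub>path_algebra G\<^esub> (\<Sum>v\<in>V. h v) = (\<Sum>v\<in>V. g \<otimes>\<^bsub>path_algebra G\<^esub> h v)"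
    if "finite V" for V and h :: "'a \<Rightarrow> ('a, 'b) path \<Rightarrow>\<^sub>0 'c" and g
    using that by induction (simp_all add: path_algebra_r_distr)
  have s: "\<one>\<^bsub>path_algebra G\<^esub> \<otimes>\<^bsub>path_algebra G\<^esub> Poly_Mapping.single \<pi> c = Poly_Mapping.single \<pi> c
     \<and> Poly_Mapping.single \<pi> c \<otimes>\<^bsub>path_algebra G\<^esub> \<one>\<^bsub>path_algebra G\<^esub> = Poly_Mapping.single \<pi> c"
    if \<pi>: "\<pi> \<in> paths G" for \<pi> :: "('a, 'b) path" and c :: 'c
  proof -
    obtain u p where [simp]: "\<pi> = (u, p)" by (cases \<pi>)
    obtain v where aw: "awalk u p v" using \<pi> by (auto simp: paths_def)
    then have uv: "u \<in> verts G" "v \<in> verts G" "path_target G (u, p) = v"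
      by (auto simp: path_target_def awlast_of_awalk)
    have t: "path_target G (w, []) = w" for w by (simp add: path_target_def)
    show ?thesis
      unfolding one suml[OF finite_verts] sumr[OF finite_verts] path_algebra_mult_single
        path_mult_def
      using uv by (simp add: path_source_def t if_distrib sum.delta sum.delta' cong: if_cong)
  qed
  have f: "f = (\<Sum>\<pi>\<in>Poly_Mapping.keys f. Poly_Mapping.single \<pi> (Poly_Mapping.lookup f \<pi>))"
    by (simp add: poly_mapping_sum_singles)
  have *: "\<one>\<^bsub>path_algebra G\<^esub> \<otimes>\<^bsub>path_algebra G\<^esub>
        (\<Sum>\<pi>\<in>P. Poly_Mapping.single \<pi> (c \<pi>)) = (\<Sum>\<pi>\<in>P. Poly_Mapping.single \<pi> (c \<pi>)) \<and>
      (\<Sum>\<pi>\<in>P. Poly_Mapping.single \<pi> (c \<pi>)) \<otimes>\<^bsub>path_algebra G\<^esub> \<one>\<^bsub>path_algebra G\<^esub>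
        = (\<Sum>\<pi>\<in>P. Poly_Mapping.single \<pi> (c \<pi>))"
    if "finite P" "P \<subseteq> paths G" for P and c :: "('a, 'b) path \<Rightarrow> 'c"
    using that by induction (simp_all add: path_algebra_l_distr path_algebra_r_distr s)
  from *[of "Poly_Mapping.keys f" "Poly_Mapping.lookup f"] assms
  show "\<one>\<^bsub>path_algebra G\<^esub> \<otimes>\<^bsub>path_algebra G\<^esub> f = f"
    and "f \<otimes>\<^bsub>path_algebra G\<^esub> \<one>\<^bsub>path_algebra G\<^esub> = f"
    by (simp_all add: path_algebra_carrier f[symmetric])
qed

lemma (in fin_digraph) ring_path_algebra:
  "ring (path_algebra G :: (('a, 'b) path \<Rightarrow>\<^sub>0 'k::field) ring)"
proof (rule ringI)
  let ?R = "path_algebra G :: (('a, 'b) path \<Rightarrow>\<^sub>0 'k) ring"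
  have add: "add ?R = (+)" "zero ?R = 0" by (simp_all add: path_algebra_def)
  show "abelian_group ?R"
  proof (rule abelian_groupI)
    fix x y assume "x \<in> carrier ?R" "y \<in> carrier ?R"
    then show "x \<oplus>\<^bsub>?R\<^esub> y \<in> carrier ?R"
      using keys_add[of x y] by (auto simp: add path_algebra_carrier)
  next
    fix x assume "x \<in> carrier ?R"
    then show "\<exists>y\<in>carrier ?R. y \<oplus>\<^bsub>?R\<^esub> x = \<zero>\<^bsub>?R\<^esub>"
      by (intro bexI[of _ "- x"]) (auto simp: add path_algebra_carrier subset_iff in_keys_iff)
  qed (auto simp: add path_algebra_carrier add_ac)
  show "monoid ?R"
  proof (rule monoidI)
    show "\<one>\<^bsub>?R\<^esub> \<in> carrier ?R"
      unfolding path_algebra_carrier unfolding path_algebra_def monoid.simps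
      by (rule keys_sum_subset) (auto simp: paths_def awalk_Nil_iff)
  qed (use path_algebra_closed path_algebra_one path_algebra_assoc in auto)
qed (simp_all add: path_algebra_l_distr path_algebra_r_distr path_algebra_def[THEN arg_cong, of add])


section \<open>Representations\<close>

definition dim_vectors :: "('v, 'e) pre_digraph \<Rightarrow> ('v \<Rightarrow> nat) set" where
  "dim_vectors Q = {\<alpha>. \<forall>v. v \<notin> verts Q \<longrightarrow> \<alpha> v = 0}"

definition Rep_quiver :: "('v, 'e) pre_digraph \<Rightarrow> ('v \<Rightarrow> nat) \<Rightarrow> ('e \<Rightarrow> 'k::field mat) set" where
  "Rep_quiver Q \<alpha> = (\<Pi>\<^sub>E a\<in>arcs Q. carrier_mat (\<alpha> (head Q a)) (\<alpha> (tail Q a)))"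

primrec path_mat ::
  "('v, 'e) pre_digraph \<Rightarrow> ('v \<Rightarrow> nat) \<Rightarrow> ('e \<Rightarrow> 'k::field mat) \<Rightarrow> 'v \<Rightarrow> 'e list \<Rightarrow> 'k mat" where
  "path_mat Q \<alpha> M u [] = 1\<^sub>m (\<alpha> u)"
| "path_mat Q \<alpha> M u (a # p) = path_mat Q \<alpha> M (head Q a) p * M a"

text \<open>
  An element \<open>f\<close> of the path algebra acts on \<open>\<Oplus>\<^sub>v k\<^bsup>\<alpha> v\<^esup>\<close>; its block from \<open>u\<close> to
  \<open>v\<close> is the combination, with the coefficients of \<open>f\<close>, of the matrices of the paths from
  \<open>u\<close> to \<open>v\<close>. The representation satisfies \<open>f\<close> if all entries of all blocks vanish.
\<close>

definition satisfies_relation ::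
  "('v, 'e) pre_digraph \<Rightarrow> ('v \<Rightarrow> nat) \<Rightarrow> ('e \<Rightarrow> 'k mat) \<Rightarrow> (('v, 'e) path \<Rightarrow>\<^sub>0 'k::field) \<Rightarrow> bool"
  where
  "satisfies_relation Q \<alpha> M f \<longleftrightarrow>
     (\<forall>u\<in>verts Q. \<forall>v\<in>verts Q. \<forall>i<\<alpha> v. \<forall>j<\<alpha> u.
       (\<Sum>\<pi> | \<pi> \<in> Poly_Mapping.keys f \<and> path_source \<pi> = u \<and> path_target Q \<pi> = v.
          Poly_Mapping.lookup f \<pi> * path_mat Q \<alpha> M (fst \<pi>) (snd \<pi>) $$ (i, j)) = 0)"

text \<open>
  The algebra \<open>A = kQ/I\<close> enters through the pair \<open>Q\<close>, \<open>I\<close>, where \<open>I\<close> is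
  any two-sided ideal of the path algebra; it need not be admissible. Over a finite field these
  sets are the sets of rational points of the varieties of the same name.
\<close>

definition Rep ::
  "('v, 'e) pre_digraph \<Rightarrow> (('v, 'e) path \<Rightarrow>\<^sub>0 'k::field) set \<Rightarrow> ('v \<Rightarrow> nat) \<Rightarrow> ('e \<Rightarrow> 'k mat) set"
  where
  "Rep Q I \<alpha> = {M \<in> Rep_quiver Q \<alpha>. \<forall>f\<in>I. satisfies_relation Q \<alpha> M f}"


subsection \<open>Subrepresentations\<close>

definition dim_subspace :: "nat \<Rightarrow> 'k::field vec set \<Rightarrow> nat" where
  "dim_subspace n W = vectorspace.dim class_ring ((module_vec TYPE('k) n)\<lparr>carrier := W\<rparr>)"

definition subreps ::
  "('v, 'e) pre_digraph \<Rightarrow> ('v \<Rightarrow> nat) \<Rightarrow> ('e \<Rightarrow> 'k::field mat) \<Rightarrow> ('v \<Rightarrow> 'k vec set) set" where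
  "subreps Q \<alpha> M =
     {L \<in> (\<Pi>\<^sub>E v\<in>verts Q. {W. VectorSpace.subspace class_ring W (module_vec TYPE('k) (\<alpha> v))}).
       \<forall>a\<in>arcs Q. \<forall>x\<in>L (tail Q a). M a *\<^sub>v x \<in> L (head Q a)}"

definition zero_subrep :: "('v, 'e) pre_digraph \<Rightarrow> ('v \<Rightarrow> nat) \<Rightarrow> 'v \<Rightarrow> 'k::field vec set" where
  "zero_subrep Q \<alpha> = (\<lambda>v\<in>verts Q. {0\<^sub>v (\<alpha> v)})"

definition full_subrep :: "('v, 'e) pre_digraph \<Rightarrow> ('v \<Rightarrow> nat) \<Rightarrow> 'v \<Rightarrow> 'k::field vec set" where
  "full_subrep Q \<alpha> = (\<lambda>v\<in>verts Q. carrier_vec (\<alpha> v))"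

definition dim_vector ::
  "('v, 'e) pre_digraph \<Rightarrow> ('v \<Rightarrow> nat) \<Rightarrow> ('v \<Rightarrow> 'k::field vec set) \<Rightarrow> 'v \<Rightarrow> nat" where
  "dim_vector Q \<alpha> L = (\<lambda>v. if v \<in> verts Q then dim_subspace (\<alpha> v) (L v) else 0)"


section \<open>Slopes and semistability\<close>

definition int_lattice :: "('v, 'e) pre_digraph \<Rightarrow> ('v \<Rightarrow> int) set" where
  "int_lattice Q = {x. \<forall>v. v \<notin> verts Q \<longrightarrow> x v = 0}"

definition weight :: "('v, 'e) pre_digraph \<Rightarrow> (('v \<Rightarrow> int) \<Rightarrow> int) \<Rightarrow> bool" where
  "weight Q \<sigma> \<longleftrightarrow> (\<forall>x\<in>int_lattice Q. \<forall>y\<in>int_lattice Q. \<sigma> (x + y) = \<sigma> x + \<sigma> y)"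

text \<open>
  The value of a slope function at the zero dimension vector is left unspecified.
\<close>

definition slope_function :: "('v, 'e) pre_digraph \<Rightarrow> (('v \<Rightarrow> nat) \<Rightarrow> rat) \<Rightarrow> bool" where
  "slope_function Q \<mu> \<longleftrightarrow>
     (\<exists>\<sigma> \<theta>. weight Q \<sigma> \<and> weight Q \<theta> \<and>
       (\<forall>\<beta>\<in>dim_vectors Q. \<beta> \<noteq> 0 \<longrightarrow> \<theta> (int \<circ> \<beta>) > 0) \<and>
       (\<forall>\<beta>\<in>dim_vectors Q. \<beta> \<noteq> 0 \<longrightarrow> \<mu> \<beta> = of_int (\<sigma> (int \<circ> \<beta>)) / of_int (\<theta> (int \<circ> \<beta>))))"

definition semistable ::
  "('v, 'e) pre_digraph \<Rightarrow> (('v \<Rightarrow> nat) \<Rightarrow> rat) \<Rightarrow> ('v \<Rightarrow> nat) \<Rightarrow> ('e \<Rightarrow> 'k::field mat) \<Rightarrow> bool" where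
  "semistable Q \<mu> \<alpha> M \<longleftrightarrow>
     (\<forall>L\<in>subreps Q \<alpha> M. L \<noteq> zero_subrep Q \<alpha> \<longrightarrow> \<mu> (dim_vector Q \<alpha> L) \<le> \<mu> \<alpha>)"

definition Rep_semistable ::
  "('v, 'e) pre_digraph \<Rightarrow> (('v, 'e) path \<Rightarrow>\<^sub>0 'k::field) set \<Rightarrow> (('v \<Rightarrow> nat) \<Rightarrow> rat) \<Rightarrow> ('v \<Rightarrow> nat)
    \<Rightarrow> ('e \<Rightarrow> 'k mat) set" where
  "Rep_semistable Q I \<mu> \<alpha> = {M \<in> Rep Q I \<alpha>. semistable Q \<mu> \<alpha> M}"


section \<open>Flags of subrepresentations\<close>

text \<open>
  The list \<open>\<alpha>s\<close> is \<open>[\<alpha>\<^sub>1, \<dots>, \<alpha>\<^sub>s]\<close>, so that \<open>\<alpha>\<^bsub>s+1-i\<^esub>\<close> is \<open>\<alpha>s ! (s - i)\<close>,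
  and \<open>Ls\<close> is \<open>[L\<^sub>1, \<dots>, L\<^bsub>s-1\<^esub>]\<close>. The condition that \<open>\<alpha>\<^bsub>s+1-i\<^esub>\<close> is the dimension
  vector of \<open>L\<^sub>i / L\<^bsub>i-1\<^esub>\<close> is written as
  \<open>dim L\<^sub>i = dim L\<^bsub>i-1\<^esub> + \<alpha>\<^bsub>s+1-i\<^esub>\<close>. When the entries of \<open>\<alpha>s\<close> are nonzero,
  it makes the inclusions strict.
\<close>

definition Frep ::
  "('v, 'e) pre_digraph \<Rightarrow> (('v, 'e) path \<Rightarrow>\<^sub>0 'k::field) set \<Rightarrow> ('v \<Rightarrow> nat) list
    \<Rightarrow> (('e \<Rightarrow> 'k mat) \<times> ('v \<Rightarrow> 'k vec set) list) set" where
  "Frep Q I \<alpha>s =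
     (let \<alpha> = sum_list \<alpha>s; s = length \<alpha>s in
       {(M, Ls). M \<in> Rep Q I \<alpha> \<and> length Ls = s - 1 \<and> set Ls \<subseteq> subreps Q \<alpha> M \<and>
         (let F = zero_subrep Q \<alpha> # Ls @ [full_subrep Q \<alpha>] in
           \<forall>i\<in>{1..s}.
             (\<forall>v\<in>verts Q. (F ! (i - 1)) v \<subseteq> (F ! i) v) \<and>
             dim_vector Q \<alpha> (F ! i) = dim_vector Q \<alpha> (F ! (i - 1)) + \<alpha>s ! (s - i))})"

text \<open>
  The ordered decompositions that index the alternating sum, again as lists
  \<open>[\<alpha>\<^sub>1, \<dots>, \<alpha>\<^sub>s]\<close>. The slope of a partial sum \<open>\<alpha>\<^sub>1 + \<dots> + \<alpha>\<^sub>j\<close> is defined for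
  \<open>j \<ge> 1\<close> only.
\<close>

definition decompositions ::
  "('v, 'e) pre_digraph \<Rightarrow> (('v \<Rightarrow> nat) \<Rightarrow> rat) \<Rightarrow> ('v \<Rightarrow> nat) \<Rightarrow> ('v \<Rightarrow> nat) list set" where
  "decompositions Q \<mu> \<alpha> =
     {\<alpha>s. \<alpha>s \<noteq> [] \<and> set \<alpha>s \<subseteq> dim_vectors Q - {0} \<and> sum_list \<alpha>s = \<alpha> \<and>
       (\<forall>j. 1 \<le> j \<and> j < length \<alpha>s \<longrightarrow> \<mu> (sum_list (take j \<alpha>s)) < \<mu> \<alpha>)}"

end

theory Submission
  imports Defs
begin

text \<open>
  Fix a representation \<open>M\<close> with dimension vector \<open>\<alpha>\<close>. A flag \<open>0 \<subset> L\<^sub>1 \<subset> \<dots> \<subset> L\<^bsub>s-1\<^esub> \<subset> M\<close> of the kind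
  counted on the right-hand side has quotients \<open>M/L\<^sub>i\<close> of slope less than \<open>\<mu>(\<alpha>)\<close>. By the seesaw
  property of slopes this says \<open>\<mu>(L\<^sub>i) > \<mu>(\<alpha>)\<close>, so the flag is an arbitrary chain in the
  finite poset \<open>D\<close> of destabilizing subrepresentations of \<open>M\<close>, and the decomposition of \<open>\<alpha>\<close> can be
  recovered from the chain (\<open>decompositions_flags_iff_chain\<close>). Exchanging the
  summations, the right-hand side becomes the sum over all \<open>M\<close> of the alternating sums
  \<open>\<Sum> (-1)\<^bsup>length c\<^esup>\<close> over the chains \<open>c\<close> in \<open>D\<close>. It remains to see that this alternating sum
  is 1 if \<open>M\<close> is semistable and 0 otherwise (\<open>sum_destabilizing_chains\<close>).

  If \<open>M\<close> is semistable, then \<open>D\<close> is empty, and the empty chain contributes 1. Otherwise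
  let \<open>f = \<sigma>(-)\<theta>(\<alpha>) - \<sigma>(\<alpha>)\<theta>(-)\<close>. This is an additive function of dimension vectors,
  positive on exactly the members of \<open>D\<close> among the nonzero subrepresentations
  (\<open>slope_function_sign\<close>). A subrepresentation \<open>H\<close> with maximal \<open>f(H)\<close> lies in \<open>D\<close>, and
  \<open>f(L + H) = f(L) + f(H) - f(L \<inter> H) \<ge> f(L)\<close> shows that \<open>D\<close> is closed under \<open>L \<mapsto> L + H\<close>. So \<open>D\<close> is
  contractible, and a sign-reversing involution on its chains gives the value 0
  (\<open>sum_chains_eq_0\<close>).

  The linear algebra needed is that the dimension is strictly monotone and modular on subspaces. As the
  field is finite, both follow from \<open>|W| = q\<^bsup>dim W\<^esup>\<close> (\<open>card_subspace\<close>).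
\<close>

section \<open>Alternating sums over chains\<close>

text \<open>
  Chains are strictly increasing lists. The assumptions say that \<open>j L\<close> is the join of \<open>L\<close> and \<open>H\<close>
  inside \<open>P\<close>. Such a poset is contractible through \<open>L \<le> L \<squnion> H \<ge> H\<close>, so the reduced Euler
  characteristic of its order complex vanishes. The proof is the corresponding sign-reversing
  involution: let \<open>L\<close> be the last member of the chain that is not above \<open>H\<close>; the
  chain is paired with the one in which the presence of \<open>L \<squnion> H\<close> immediately after \<open>L\<close> is toggled.
  If all members are above \<open>H\<close>, then \<open>H\<close> itself is toggled as the first one.
\<close>

lemma sum_chains_eq_0:
  fixes P :: "'a::order set"
  assumes "H \<in> P"
    and join_in: "\<And>L. L \<in> P \<Longrightarrow> j L \<in> P"
    and join_ge: "\<And>L. L \<in> P \<Longrightarrow> L \<le> j L" "\<And>L. L \<in> P \<Longrightarrow> H \<le> j L"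
    and join_least: "\<And>L K. L \<in> P \<Longrightarrow> K \<in> P \<Longrightarrow> L \<le> K \<Longrightarrow> H \<le> K \<Longrightarrow> j L \<le> K"
  shows "(\<Sum>c | set c \<subseteq> P \<and> sorted_wrt (<) c. (-1::int) ^ length c) = 0"
proof -
  define C where "C = {c. set c \<subseteq> P \<and> sorted_wrt (<) c}"
  define apex where "apex ys = (if ys = [] then H else j (last ys))" for ys
  define toggle where "toggle c =
    (let ys = takeWhile (\<lambda>x. \<not> H \<le> x) c; zs = dropWhile (\<lambda>x. \<not> H \<le> x) c
     in if zs \<noteq> [] \<and> hd zs = apex ys then ys @ tl zs else ys @ apex ys # zs)" for c
  (* Computed on any splitting of a chain at H, so that it also applies to the toggled chain,
     which splits at the same place. *)
  have toggle_append: "toggle (ys @ zs) =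
      (if zs \<noteq> [] \<and> hd zs = apex ys then ys @ tl zs else ys @ apex ys # zs)"
    if "\<forall>y\<in>set ys. \<not> H \<le> y" "\<forall>z\<in>set zs. H \<le> z" for ys zs
  proof -
    have "takeWhile (\<lambda>x. \<not> H \<le> x) zs = []" "dropWhile (\<lambda>x. \<not> H \<le> x) zs = zs"
      using that(2) by (cases zs; simp)+
    then show ?thesis
      using that(1) by (simp add: toggle_def)
  qed
  have toggle: "toggle c \<in> C \<and> toggle (toggle c) = c
      \<and> (-1::int) ^ length (toggle c) = - ((-1) ^ length c)" if c: "c \<in> C" for c
  proof -
    define ys where "ys = takeWhile (\<lambda>x. \<not> H \<le> x) c"
    define zs where "zs = dropWhile (\<lambda>x. \<not> H \<le> x) c"
    have c_eq: "c = ys @ zs" by (simp add: ys_def zs_def)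
    have ys: "\<forall>y\<in>set ys. \<not> H \<le> y" by (auto simp: ys_def dest: set_takeWhileD)
    have sorted: "sorted_wrt (<) ys" "sorted_wrt (<) zs" "\<forall>y\<in>set ys. \<forall>z\<in>set zs. y < z"
      and P: "set ys \<subseteq> P" "set zs \<subseteq> P"
      using c unfolding C_def c_eq by (auto simp: sorted_wrt_append)
    have zs: "\<forall>z\<in>set zs. H \<le> z"
    proof (cases zs)
      case (Cons z zs')
      then have "H \<le> z" using hd_dropWhile[of "\<lambda>x. \<not> H \<le> x" c] by (simp add: zs_def)
      then show ?thesis using sorted(2) Cons by auto
    qed simp
    have apex: "apex ys \<in> P" "H \<le> apex ys"
      using \<open>H \<in> P\<close> P(1) join_in join_ge(2) by (auto simp: apex_def dest: last_in_set)
    have "y \<le> apex ys" if "y \<in> set ys" for y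
    proof -
      have "y \<le> last ys"
        using that sorted(1) by (induction ys rule: rev_induct) (auto simp: sorted_wrt_append)
      moreover have "last ys \<in> P" using that P(1) last_in_set[of ys] by (cases ys) (auto simp del: last.simps)
      ultimately show ?thesis using that join_ge(1)[of "last ys"] by (auto simp: apex_def)
    qed
    then have above: "\<forall>y\<in>set ys. y < apex ys"
      using ys apex(2) by (metis order_less_le)
    have below: "apex ys \<le> z" if "z \<in> set zs" for z
    proof (cases "ys = []")
      case False
      then have "last ys \<in> set ys" by simp
      then have "last ys \<in> P" "last ys \<le> z"
        using P(1) sorted(3) that by (auto intro: less_imp_le)
      then show ?thesis
        using False that zs P(2) join_least by (auto simp: apex_def)
    qed (use that zs in \<open>simp add: apex_def\<close>)
    show ?thesis
    proof (cases "zs \<noteq> [] \<and> hd zs = apex ys")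
      case True
      then obtain zs' where zs': "zs = apex ys # zs'" by (cases zs) auto
      then have t: "toggle c = ys @ zs'"
        using toggle_append[OF ys zs] by (simp add: c_eq)
      have "toggle (ys @ zs') = ys @ apex ys # zs'"
        using toggle_append[OF ys, of zs'] zs sorted(2) by (cases zs') (auto simp: zs')
      then show ?thesis
        using t sorted P unfolding C_def by (auto simp: c_eq zs' sorted_wrt_append)
    next
      case False
      then have t: "toggle c = ys @ apex ys # zs"
        using toggle_append[OF ys zs] unfolding if_not_P[OF False] by (simp add: c_eq)
      have "toggle (ys @ apex ys # zs) = ys @ zs"
        using toggle_append[OF ys, of "apex ys # zs"] zs apex(2) by simp
      moreover have "apex ys < z" if "z \<in> set zs" for z
      proof -
        obtain z' zs' where zs': "zs = z' # zs'" using \<open>z \<in> set zs\<close> by (cases zs) auto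
        have "apex ys < z'" using below[of z'] False by (auto simp: zs' order_less_le)
        then show ?thesis using that sorted(2) by (auto simp: zs' intro: less_trans)
      qed
      ultimately show ?thesis
        using t sorted P apex above unfolding C_def by (auto simp: c_eq sorted_wrt_append)
    qed
  qed
  have "(\<Sum>c\<in>C. (-1::int) ^ length c) = (\<Sum>c\<in>C. - ((-1) ^ length c))"
    by (rule sum.reindex_bij_witness[of _ toggle toggle]) (use toggle in auto)
  then show ?thesis by (simp add: C_def sum_negf)
qed

lemma finite_chains:
  fixes P :: "'a::order set"
  assumes "finite P"
  shows "finite {c. set c \<subseteq> P \<and> sorted_wrt (<) c}"
proof (rule finite_subset[OF _ finite_subset_distinct[OF assms]])
  have "sorted_wrt (<) c \<Longrightarrow> distinct c" for c :: "'a list" by (induction c) auto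
  then show "{c. set c \<subseteq> P \<and> sorted_wrt (<) c} \<subseteq> {c. set c \<subseteq> P \<and> distinct c}" by auto
qed

section \<open>Subspaces over a finite field\<close>

lemma subspace_vec_iff:
  "VectorSpace.subspace class_ring W (module_vec TYPE('k::field) n) \<longleftrightarrow>
     W \<subseteq> carrier_vec n \<and> 0\<^sub>v n \<in> W \<and> (\<forall>x\<in>W. \<forall>y\<in>W. x + y \<in> W) \<and> (\<forall>c. \<forall>x\<in>W. c \<cdot>\<^sub>v x \<in> W)"
  using vec_vs[where ?'a = 'k, of n] vec_module[where ?'a = 'k, of n]
  by (auto simp: VectorSpace.subspace_def submodule_def module_vec_simps)

lemma finite_carrier_vec: "finite (carrier_vec n :: 'k::finite vec set)"
proof (rule finite_subset)
  show "carrier_vec n \<subseteq> vec n ` ({..<n} \<rightarrow>\<^sub>E (UNIV :: 'k set))"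
  proof
    fix x :: "'k vec" assume "x \<in> carrier_vec n"
    then show "x \<in> vec n ` ({..<n} \<rightarrow>\<^sub>E UNIV)"
      by (intro image_eqI[of _ _ "restrict (($) x) {..<n}"]) auto
  qed
qed (simp add: finite_PiE)

lemma finite_carrier_mat: "finite (carrier_mat m n :: 'k::finite mat set)"
proof (rule finite_subset)
  show "carrier_mat m n \<subseteq> mat m n ` ({..<m} \<times> {..<n} \<rightarrow>\<^sub>E (UNIV :: 'k set))"
  proof
    fix x :: "'k mat" assume "x \<in> carrier_mat m n"
    then show "x \<in> mat m n ` ({..<m} \<times> {..<n} \<rightarrow>\<^sub>E UNIV)"
      by (intro image_eqI[of _ _ "restrict (($$) x) ({..<m} \<times> {..<n})"]) auto
  qed
qed (simp add: finite_PiE)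

text \<open>
  A basis of \<open>W\<close> identifies \<open>W\<close> with the functions from the basis to the field. Over a finite field
  the dimension is thereby determined by the cardinality, and the facts on dimensions below
  reduce to counting.
\<close>

lemma card_subspace:
  fixes W :: "'k::{field, finite} vec set"
  assumes W: "VectorSpace.subspace class_ring W (module_vec TYPE('k) n)"
  shows "card W = card (UNIV :: 'k set) ^ dim_subspace n W"
proof -
  interpret V: vectorspace "class_ring :: 'k ring" "module_vec TYPE('k) n" by (rule vec_vs)
  let ?W = "(module_vec TYPE('k) n)\<lparr>carrier := W\<rparr>"
  interpret W: vectorspace "class_ring :: 'k ring" ?W
    by (rule V.subspace_is_vs[OF W])
  have "finite W"
    using W finite_carrier_vec finite_subset by (auto simp: subspace_vec_iff)
  have "W.fin_dim"
    unfolding W.fin_dim_def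
    using \<open>finite W\<close> W.in_own_span[of W] W.span_is_subset2[of W] by auto
  then obtain B where B: "finite B" "W.basis B" 
    using W.finite_basis_exists by blast
  then have "B \<subseteq> W" by (simp add: W.basis_def)
  have ex1: "\<forall>v\<in>W. \<exists>!a. a \<in> B \<rightarrow>\<^sub>E UNIV \<and> W.lincomb a B = v"
    using W.basis_criterion[OF B(1)] B(2) \<open>B \<subseteq> W\<close> by simp
  have "bij_betw (\<lambda>a. W.lincomb a B) (B \<rightarrow>\<^sub>E UNIV) W"
    unfolding bij_betw_def
  proof
    have cl: "W.lincomb a B \<in> W" for a
      using W.lincomb_closed[of B a] \<open>B \<subseteq> W\<close> B(1) by simp
    show "inj_on (\<lambda>a. W.lincomb a B) (B \<rightarrow>\<^sub>E UNIV)"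
      using ex1 cl by (intro inj_onI) metis
    show "(\<lambda>a. W.lincomb a B) ` (B \<rightarrow>\<^sub>E UNIV) = W"
    proof
      show "(\<lambda>a. W.lincomb a B) ` (B \<rightarrow>\<^sub>E UNIV) \<subseteq> W" using cl by blast
      show "W \<subseteq> (\<lambda>a. W.lincomb a B) ` (B \<rightarrow>\<^sub>E UNIV)"
      proof
        fix v assume "v \<in> W"
        then obtain a where "a \<in> B \<rightarrow>\<^sub>E UNIV" "W.lincomb a B = v"
          using ex1 by (meson ex1_implies_ex)
        then show "v \<in> (\<lambda>a. W.lincomb a B) ` (B \<rightarrow>\<^sub>E UNIV)" by blast
      qed
    qed
  qed
  then have "card W = card (B \<rightarrow>\<^sub>E (UNIV :: 'k set))"
    by (simp add: bij_betw_same_card)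
  then show ?thesis
    using B by (simp add: card_PiE dim_subspace_def W.dim_basis)
qed

lemma card_field_ge_2: "card (UNIV :: 'k::{field, finite} set) \<ge> 2"
proof -
  have "card {0 :: 'k, 1} \<le> card (UNIV :: 'k set)" by (rule card_mono) auto
  then show ?thesis by simp
qed

lemma dim_subspace_strict_mono:
  fixes U W :: "'k::{field, finite} vec set"
  assumes U: "VectorSpace.subspace class_ring U (module_vec TYPE('k) n)"
    and W: "VectorSpace.subspace class_ring W (module_vec TYPE('k) n)"
    and "U \<subset> W"
  shows "dim_subspace n U < dim_subspace n W"
proof -
  have "finite W"
    using W finite_carrier_vec finite_subset by (auto simp: subspace_vec_iff)
  then have "card U < card W" using \<open>U \<subset> W\<close> by (rule psubset_card_mono)
  then show ?thesis
    using card_field_ge_2[where ?'k = 'k]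
    by (simp add: card_subspace[OF U] card_subspace[OF W])
qed

lemma dim_subspace_zero:
  "dim_subspace n {0\<^sub>v n :: 'k::{field, finite} vec} = 0"
proof -
  have "VectorSpace.subspace class_ring {0\<^sub>v n :: 'k vec} (module_vec TYPE('k) n)"
    by (auto simp: subspace_vec_iff)
  from card_subspace[OF this] have "card (UNIV :: 'k set) ^ dim_subspace n {0\<^sub>v n :: 'k vec} =
      card (UNIV :: 'k set) ^ 0"
    by simp
  then show ?thesis
    using card_field_ge_2[where ?'k = 'k] by (subst (asm) power_inject_exp) auto
qed

lemma dim_subspace_full:
  "dim_subspace n (carrier_vec n :: 'k::field vec set) = n"
proof -
  interpret vec_space "TYPE('k)" n .
  have "V\<lparr>carrier := carrier_vec n\<rparr> = V" by (simp add: module_vec_def)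
  then show ?thesis unfolding dim_subspace_def using dim_is_n by metis
qed

definition vec_sum :: "'k::plus vec set \<Rightarrow> 'k vec set \<Rightarrow> 'k vec set" where
  "vec_sum U W = (\<lambda>(x, y). x + y) ` (U \<times> W)"

lemma subspace_vec_sum:
  fixes U W :: "'k::field vec set"
  assumes U: "VectorSpace.subspace class_ring U (module_vec TYPE('k) n)"
    and W: "VectorSpace.subspace class_ring W (module_vec TYPE('k) n)"
  shows "VectorSpace.subspace class_ring (vec_sum U W) (module_vec TYPE('k) n)"
    and "U \<subseteq> vec_sum U W" and "W \<subseteq> vec_sum U W"
proof -
  note UW = U[unfolded subspace_vec_iff] W[unfolded subspace_vec_iff]
  have car: "x \<in> carrier_vec n" if "x \<in> U \<union> W" for x using that UW by auto
  have sumI: "x + y \<in> vec_sum U W" if "x \<in> U" "y \<in> W" for x y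
    using that by (auto simp: vec_sum_def)
  show "U \<subseteq> vec_sum U W"
  proof
    fix x assume "x \<in> U"
    then show "x \<in> vec_sum U W" using sumI[of x "0\<^sub>v n"] UW car by auto
  qed
  show "W \<subseteq> vec_sum U W"
  proof
    fix x assume "x \<in> W"
    then show "x \<in> vec_sum U W" using sumI[of "0\<^sub>v n" x] UW car by auto
  qed
  have "0\<^sub>v n \<in> vec_sum U W" using \<open>U \<subseteq> vec_sum U W\<close> UW by auto
  moreover have "vec_sum U W \<subseteq> carrier_vec n" using car by (auto simp: vec_sum_def)
  moreover have "p + q \<in> vec_sum U W" if pq: "p \<in> vec_sum U W" "q \<in> vec_sum U W" for p q
  proof -
    obtain x y x' y' where *: "p = x + y" "q = x' + y'" "x \<in> U" "y \<in> W" "x' \<in> U" "y' \<in> W"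
      using pq by (auto simp: vec_sum_def)
    have "p + q = (x + x') + (y + y')"
      using * car[of x] car[of y] car[of x'] car[of y'] by (auto intro!: eq_vecI)
    then show ?thesis using sumI[of "x + x'" "y + y'"] * UW by auto
  qed
  moreover have "c \<cdot>\<^sub>v p \<in> vec_sum U W" if "p \<in> vec_sum U W" for c p
  proof -
    obtain x y where *: "p = x + y" "x \<in> U" "y \<in> W"
      using \<open>p \<in> vec_sum U W\<close> by (auto simp: vec_sum_def)
    have "c \<cdot>\<^sub>v p = c \<cdot>\<^sub>v x + c \<cdot>\<^sub>v y"
      using * car[of x] car[of y] smult_add_distrib_vec[of x n y c] by auto
    then show ?thesis using sumI[of "c \<cdot>\<^sub>v x" "c \<cdot>\<^sub>v y"] * UW by auto
  qed
  ultimately show "VectorSpace.subspace class_ring (vec_sum U W) (module_vec TYPE('k) n)"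
    unfolding subspace_vec_iff by blast
qed

text \<open>
  The addition map from \<open>U \<times> W\<close> onto \<open>U + W\<close> has all its fibres in bijection with \<open>U \<inter> W\<close>, so
  \<open>|U| |W| = |U + W| |U \<inter> W|\<close>.
\<close>

lemma dim_subspace_vec_sum:
  fixes U W :: "'k::{field, finite} vec set"
  assumes U: "VectorSpace.subspace class_ring U (module_vec TYPE('k) n)"
    and W: "VectorSpace.subspace class_ring W (module_vec TYPE('k) n)"
  shows "dim_subspace n (vec_sum U W) + dim_subspace n (U \<inter> W)
    = dim_subspace n U + dim_subspace n W"
proof -
  note UW = U[unfolded subspace_vec_iff] W[unfolded subspace_vec_iff]
  have fin: "finite U" "finite W" using UW finite_carrier_vec finite_subset by blast+
  have car: "x \<in> carrier_vec n" if "x \<in> U \<union> W" for x using that UW by auto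
  have diff: "x - y \<in> X"
    if "X = U \<or> X = W" "x \<in> X" "y \<in> X" for X x y
  proof -
    have "x - y = x + (-1) \<cdot>\<^sub>v y" using that car[of x] car[of y] by (auto intro!: eq_vecI)
    then show ?thesis using that UW by auto
  qed
  have fibre: "card {p \<in> U \<times> W. (case p of (x, y) \<Rightarrow> x + y) = s} = card (U \<inter> W)"
    if s: "s \<in> vec_sum U W" for s
  proof -
    obtain a b where ab: "a \<in> U" "b \<in> W" "s = a + b" using s by (auto simp: vec_sum_def)
    (* The fibre over a + b is the coset of the antidiagonal of the intersection through (a, b). *)
    have "bij_betw (\<lambda>z. (a + z, b - z)) (U \<inter> W) {p \<in> U \<times> W. (case p of (x, y) \<Rightarrow> x + y) = s}"
    proof (rule bij_betw_byWitness[where f' = "\<lambda>p. fst p - a"])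
      have "a + z - a = z" if "z \<in> U" for z
        using car[of z] car[of a] that ab by (auto intro!: eq_vecI)
      then show "\<forall>z\<in>U \<inter> W. fst (a + z, b - z) - a = z" by auto
      have "b - (x - a) = y" "a + (x - a) = x" if "x \<in> U" "y \<in> W" "x + y = s" for x y
      proof -
        have dims: "dim_vec x = n" "dim_vec y = n" "dim_vec a = n" "dim_vec b = n"
          using car[of x] car[of y] car[of a] car[of b] that ab by auto
        have eq: "x $ i + y $ i = a $ i + b $ i" if "i < n" for i
          using arg_cong[OF \<open>x + y = s\<close>, of "\<lambda>v. v $ i"] that dims ab by simp
        show "a + (x - a) = x" by (rule eq_vecI) (use dims in auto)
        show "b - (x - a) = y"
          by (rule eq_vecI) (use dims eq in \<open>auto simp: algebra_simps\<close>)
      qed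
      then show "\<forall>p\<in>{p \<in> U \<times> W. (case p of (x, y) \<Rightarrow> x + y) = s}. (a + (fst p - a), b - (fst p - a)) = p"
        by auto
      have "a + z + (b - z) = s" if "z \<in> U \<inter> W" for z
        using car[of z] car[of a] car[of b] that ab by (auto intro!: eq_vecI)
      then show "(\<lambda>z. (a + z, b - z)) ` (U \<inter> W) \<subseteq> {p \<in> U \<times> W. (case p of (x, y) \<Rightarrow> x + y) = s}"
        using UW ab diff by auto
      show "(\<lambda>p. fst p - a) ` {p \<in> U \<times> W. (case p of (x, y) \<Rightarrow> x + y) = s} \<subseteq> U \<inter> W"
      proof clarify
        fix x y assume xy: "x \<in> U" "y \<in> W" "s = x + y"
        have dims: "dim_vec x = n" "dim_vec y = n" "dim_vec a = n" "dim_vec b = n"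
          using car[of x] car[of y] car[of a] car[of b] xy ab by auto
        have eq: "x $ i + y $ i = a $ i + b $ i" if "i < n" for i
          using arg_cong[OF \<open>s = x + y\<close>, of "\<lambda>v. v $ i"] that dims ab by simp
        have "x - a = b - y"
          by (rule eq_vecI) (use dims eq in \<open>auto simp: algebra_simps\<close>)
        then show "fst (x, y) - a \<in> U \<inter> W" using diff[of U x a] diff[of W b y] xy ab by auto
      qed
    qed
    then show ?thesis by (simp add: bij_betw_same_card)
  qed
  have "card U * card W = card (U \<times> W)" by (simp add: card_cartesian_product)
  also have "\<dots> = (\<Sum>s\<in>vec_sum U W. card {p \<in> U \<times> W. (case p of (x, y) \<Rightarrow> x + y) = s})"
    using sum.image_gen[of "U \<times> W" "\<lambda>_. 1 :: nat" "\<lambda>(x, y). x + y"] fin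
    by (simp add: vec_sum_def)
  also have "\<dots> = card (vec_sum U W) * card (U \<inter> W)" by (simp add: fibre)
  finally have "card U * card W = card (vec_sum U W) * card (U \<inter> W)" .
  moreover have "VectorSpace.subspace class_ring (U \<inter> W) (module_vec TYPE('k) n)"
    using UW by (auto simp: subspace_vec_iff)
  ultimately have "card (UNIV :: 'k set) ^ (dim_subspace n U + dim_subspace n W)
    = card (UNIV :: 'k set) ^ (dim_subspace n (vec_sum U W) + dim_subspace n (U \<inter> W))"
    using U W subspace_vec_sum(1)[OF U W] by (simp add: card_subspace power_add)
  then show ?thesis
    using card_field_ge_2[where ?'k = 'k] by simp
qed

section \<open>The lattice of subrepresentations\<close>

text \<open>
  The subrepresentations of a representation of \<open>kQ/I\<close> are those of the underlying
  representation of \<open>Q\<close>, so their lattice is studied for one fixed \<open>M\<close> in \<open>Rep_quiver Q \<alpha>\<close>.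
\<close>

locale quiver_rep = fin_digraph Q for Q :: "('v, 'e) pre_digraph" +
  fixes \<alpha> :: "'v \<Rightarrow> nat" and M :: "'e \<Rightarrow> 'k::{field, finite} mat"
  assumes rep: "M \<in> Rep_quiver Q \<alpha>"
begin

abbreviation "sub \<equiv> subreps Q \<alpha> M"
abbreviation "dimv \<equiv> dim_vector Q \<alpha>"

lemma rep_carrier: "a \<in> arcs Q \<Longrightarrow> M a \<in> carrier_mat (\<alpha> (head Q a)) (\<alpha> (tail Q a))"
  using rep by (auto simp: Rep_quiver_def)

lemma subrep_subspace:
  "L \<in> sub \<Longrightarrow> v \<in> verts Q \<Longrightarrow> VectorSpace.subspace class_ring (L v) (module_vec TYPE('k) (\<alpha> v))"
  by (auto simp: subreps_def PiE_iff)

lemma subrep_carrier: "L \<in> sub \<Longrightarrow> v \<in> verts Q \<Longrightarrow> L v \<subseteq> carrier_vec (\<alpha> v)"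
  using subrep_subspace by (auto simp: subspace_vec_iff)

lemma subrep_undefined: "L \<in> sub \<Longrightarrow> v \<notin> verts Q \<Longrightarrow> L v = undefined"
  by (auto simp: subreps_def)

text \<open>
  Outside the vertices all subrepresentations take the same default value, so inclusion is the
  pointwise order on functions, and chains of subrepresentations are chains of that order.
\<close>

lemma subrep_le_iff:
  assumes "L \<in> sub" "K \<in> sub"
  shows "L \<le> K \<longleftrightarrow> (\<forall>v\<in>verts Q. L v \<subseteq> K v)"
  using assms by (auto simp: le_fun_def) (metis subrep_undefined subsetD)

lemma finite_subreps: "finite sub"
proof (rule finite_subset)
  show "sub \<subseteq> (\<Pi>\<^sub>E v\<in>verts Q. Pow (carrier_vec (\<alpha> v)))"
    using subrep_carrier by (auto simp: subreps_def PiE_def)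
qed (simp add: finite_PiE finite_carrier_vec)

lemma zero_subrep_in: "zero_subrep Q \<alpha> \<in> sub"
proof -
  have "M a *\<^sub>v 0\<^sub>v (\<alpha> (tail Q a)) = 0\<^sub>v (\<alpha> (head Q a))" if "a \<in> arcs Q" for a
    using rep_carrier[OF that] by (intro eq_vecI) auto
  then show ?thesis by (auto simp: subreps_def zero_subrep_def subspace_vec_iff)
qed

lemma full_subrep_in: "full_subrep Q \<alpha> \<in> sub"
  using mult_mat_vec_carrier[OF rep_carrier]
  by (auto simp: subreps_def full_subrep_def subspace_vec_iff)

lemma zero_subrep_le: "L \<in> sub \<Longrightarrow> zero_subrep Q \<alpha> \<le> L"
  using subrep_subspace unfolding subrep_le_iff[OF zero_subrep_in]
  by (auto simp: zero_subrep_def subspace_vec_iff)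

lemma le_full_subrep: "L \<in> sub \<Longrightarrow> L \<le> full_subrep Q \<alpha>"
  using subrep_carrier unfolding subrep_le_iff[OF _ full_subrep_in]
  by (simp add: full_subrep_def)

lemma dimv_in_dim_vectors: "dimv L \<in> dim_vectors Q"
  by (simp add: dim_vector_def dim_vectors_def)

lemma dimv_zero: "dimv (zero_subrep Q \<alpha> :: 'v \<Rightarrow> 'k vec set) = 0"
  by (auto simp: dim_vector_def zero_subrep_def dim_subspace_zero)

lemma dimv_full:
  assumes "\<alpha> \<in> dim_vectors Q"
  shows "dimv (full_subrep Q \<alpha> :: 'v \<Rightarrow> 'k vec set) = \<alpha>"
  using assms by (auto simp: dim_vector_def full_subrep_def dim_subspace_full dim_vectors_def)

lemma dimv_strict_mono:
  assumes L: "L \<in> sub" and K: "K \<in> sub" and "L < K"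
  shows "dimv L < dimv K"
proof -
  have le: "L v \<subseteq> K v" for v
    using less_imp_le[OF \<open>L < K\<close>] by (simp add: le_fun_def)
  have strict: "dim_subspace (\<alpha> v) (L v) < dim_subspace (\<alpha> v) (K v)"
    if "v \<in> verts Q" "L v \<noteq> K v" for v
    using dim_subspace_strict_mono subrep_subspace L K le[of v] that by blast
  then have "dimv L v \<le> dimv K v" for v
    by (cases "L v = K v") (auto simp: dim_vector_def intro: less_imp_le)
  moreover obtain v where v: "L v \<noteq> K v" using \<open>L < K\<close> by (metis ext less_irrefl)
  moreover from v have "v \<in> verts Q" using subrep_undefined L K by metis
  then have "dimv L v \<noteq> dimv K v" using strict[of v] v by (simp add: dim_vector_def)
  ultimately show ?thesis by (metis le_funI order_less_le)
qed

definition subrep_sum :: "('v \<Rightarrow> 'k vec set) \<Rightarrow> ('v \<Rightarrow> 'k vec set) \<Rightarrow> 'v \<Rightarrow> 'k vec set" where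
  "subrep_sum L K = (\<lambda>v\<in>verts Q. vec_sum (L v) (K v))"

definition subrep_int :: "('v \<Rightarrow> 'k vec set) \<Rightarrow> ('v \<Rightarrow> 'k vec set) \<Rightarrow> 'v \<Rightarrow> 'k vec set" where
  "subrep_int L K = (\<lambda>v\<in>verts Q. L v \<inter> K v)"

lemma subrep_sum_in:
  assumes L: "L \<in> sub" and K: "K \<in> sub"
  shows "subrep_sum L K \<in> sub"
proof -
  have "M a *\<^sub>v z \<in> vec_sum (L (head Q a)) (K (head Q a))"
    if a: "a \<in> arcs Q" and z: "z \<in> vec_sum (L (tail Q a)) (K (tail Q a))" for a z
  proof -
    obtain x y where xy: "x \<in> L (tail Q a)" "y \<in> K (tail Q a)" "z = x + y"
      using z by (auto simp: vec_sum_def)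
    have "x \<in> carrier_vec (\<alpha> (tail Q a))" "y \<in> carrier_vec (\<alpha> (tail Q a))"
      using xy subrep_carrier[OF L] subrep_carrier[OF K] tail_in_verts[OF a] by auto
    then have "M a *\<^sub>v z = M a *\<^sub>v x + M a *\<^sub>v y"
      using mult_add_distrib_mat_vec[OF rep_carrier[OF a]] xy(3) by simp
    moreover have "M a *\<^sub>v x \<in> L (head Q a)" "M a *\<^sub>v y \<in> K (head Q a)"
      using L K a xy by (auto simp: subreps_def)
    ultimately show ?thesis by (auto simp: vec_sum_def)
  qed
  then show ?thesis
    using subspace_vec_sum(1)[OF subrep_subspace[OF L] subrep_subspace[OF K]]
    by (simp add: subreps_def subrep_sum_def)
qed

lemma subrep_int_in:
  assumes L: "L \<in> sub" and K: "K \<in> sub"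
  shows "subrep_int L K \<in> sub"
  using subrep_subspace[OF L] subrep_subspace[OF K] L K
  by (auto simp: subrep_int_def subreps_def subspace_vec_iff)

lemma subrep_sum_least:
  assumes L: "L \<in> sub" and K: "K \<in> sub"
  shows "L \<le> subrep_sum L K" "K \<le> subrep_sum L K"
    and "N \<in> sub \<Longrightarrow> L \<le> N \<Longrightarrow> K \<le> N \<Longrightarrow> subrep_sum L K \<le> N"
proof -
  show "L \<le> subrep_sum L K" "K \<le> subrep_sum L K"
    using subspace_vec_sum(2,3)[OF subrep_subspace[OF L] subrep_subspace[OF K]]
    unfolding subrep_le_iff[OF L subrep_sum_in[OF L K]] subrep_le_iff[OF K subrep_sum_in[OF L K]]
    by (simp_all add: subrep_sum_def)
  assume N: "N \<in> sub" and "L \<le> N" "K \<le> N"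
  then have "vec_sum (L v) (K v) \<subseteq> N v" if "v \<in> verts Q" for v
    using subrep_subspace[OF N that] le_funD[OF \<open>L \<le> N\<close>, of v] le_funD[OF \<open>K \<le> N\<close>, of v]
    by (auto simp: vec_sum_def subspace_vec_iff) blast
  then show "subrep_sum L K \<le> N"
    by (simp add: subrep_le_iff subrep_sum_in L K N) (simp add: subrep_sum_def)
qed

lemma dimv_sum_int:
  assumes L: "L \<in> sub" and K: "K \<in> sub"
  shows "dimv (subrep_sum L K) + dimv (subrep_int L K) = dimv L + dimv K"
  using dim_subspace_vec_sum[OF subrep_subspace[OF L] subrep_subspace[OF K]]
  by (auto simp: dim_vector_def subrep_sum_def subrep_int_def)

text \<open>
  This is the heart of the proof. Let \<open>H\<close> be a subrepresentation at which the additive function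
  \<open>f \<circ> dim\<close> is maximal. For every subrepresentation \<open>L\<close>, the dimension formula gives
  \<open>f(L + H) = f(L) + (f(H) - f(L \<inter> H)) \<ge> f(L)\<close>. Hence adding \<open>H\<close> does not lead out of the set
  \<open>D\<close> of subrepresentations with positive value, and if \<open>D\<close> is nonempty, then it contains
  \<open>H\<close> as well as all joins with \<open>H\<close>, so that its chains cancel. If \<open>D\<close> is empty, only the empty chain is left.
\<close>

lemma sum_destabilizing_chains:
  fixes f :: "('v \<Rightarrow> nat) \<Rightarrow> int"
  assumes add: "\<And>\<beta> \<gamma>. \<beta> \<in> dim_vectors Q \<Longrightarrow> \<gamma> \<in> dim_vectors Q \<Longrightarrow> f (\<beta> + \<gamma>) = f \<beta> + f \<gamma>"
  defines "D \<equiv> {L \<in> sub. f (dimv L) > 0}"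
  shows "(\<Sum>c | set c \<subseteq> D \<and> sorted_wrt (<) c. (-1::int) ^ length c) = (if D = {} then 1 else 0)"
proof (cases "D = {}")
  case True
  then have "{c. set c \<subseteq> D \<and> sorted_wrt (<) c} = {[]}" by auto
  then show ?thesis using True by simp
next
  case False
  let ?g = "\<lambda>L. f (dimv L)"
  obtain H where H: "H \<in> sub" "\<And>L. L \<in> sub \<Longrightarrow> ?g L \<le> ?g H"
  proof -
    have fin: "finite (?g ` sub)" "?g ` sub \<noteq> {}"
      using finite_subreps zero_subrep_in by auto
    from Max_in[OF this] obtain H where "H \<in> sub" "?g H = Max (?g ` sub)" by auto
    then show thesis using that Max_ge[OF fin(1)] by simp
  qed
  have "H \<in> D" using H False unfolding D_def by force
  have sum_in: "subrep_sum L H \<in> D" if "L \<in> D" for L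
  proof -
    have L: "L \<in> sub" "?g L > 0" using that by (auto simp: D_def)
    have "?g (subrep_sum L H) + ?g (subrep_int L H) = ?g L + ?g H"
      using dimv_sum_int[OF L(1) H(1)] by (metis add dimv_in_dim_vectors)
    moreover have "?g (subrep_int L H) \<le> ?g H" using H subrep_int_in L(1) by simp
    ultimately show ?thesis using L H subrep_sum_in by (simp add: D_def)
  qed
  have "(\<Sum>c | set c \<subseteq> D \<and> sorted_wrt (<) c. (-1::int) ^ length c) = 0"
    by (rule sum_chains_eq_0[of H D "\<lambda>L. subrep_sum L H"])
      (use \<open>H \<in> D\<close> sum_in subrep_sum_least H(1) in \<open>auto simp: D_def\<close>)
  then show ?thesis using False by simp
qed

end

section \<open>Slopes and decompositions\<close>

text \<open>
  Clearing denominators, comparison with the slope \<open>\<sigma>(\<alpha>)/\<theta>(\<alpha>)\<close> becomes the sign of the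
  functional \<open>\<beta> \<mapsto> \<sigma>(\<beta>)\<theta>(\<alpha>) - \<sigma>(\<alpha>)\<theta>(\<beta>)\<close>, which is additive and
  vanishes at \<open>\<alpha>\<close>.
\<close>

lemma slope_function_sign:
  assumes "slope_function Q \<mu>" "\<alpha> \<in> dim_vectors Q" "\<alpha> \<noteq> 0"
  obtains f :: "('v \<Rightarrow> nat) \<Rightarrow> int" where
    "\<And>\<beta> \<gamma>. \<beta> \<in> dim_vectors Q \<Longrightarrow> \<gamma> \<in> dim_vectors Q \<Longrightarrow> f (\<beta> + \<gamma>) = f \<beta> + f \<gamma>"
    and "f \<alpha> = 0"
    and "\<And>\<beta>. \<beta> \<in> dim_vectors Q \<Longrightarrow> \<beta> \<noteq> 0 \<Longrightarrow> \<mu> \<beta> < \<mu> \<alpha> \<longleftrightarrow> f \<beta> < 0"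
    and "\<And>\<beta>. \<beta> \<in> dim_vectors Q \<Longrightarrow> \<beta> \<noteq> 0 \<Longrightarrow> \<mu> \<alpha> < \<mu> \<beta> \<longleftrightarrow> 0 < f \<beta>"
proof -
  obtain \<sigma> \<theta> where w: "weight Q \<sigma>" "weight Q \<theta>"
    and pos: "\<And>\<beta>. \<beta> \<in> dim_vectors Q \<Longrightarrow> \<beta> \<noteq> 0 \<Longrightarrow> \<theta> (int \<circ> \<beta>) > 0"
    and \<mu>: "\<And>\<beta>. \<beta> \<in> dim_vectors Q \<Longrightarrow> \<beta> \<noteq> 0 \<Longrightarrow>
      \<mu> \<beta> = of_int (\<sigma> (int \<circ> \<beta>)) / of_int (\<theta> (int \<circ> \<beta>))"
    using assms(1) unfolding slope_function_def by metis
  define f where "f \<beta> = \<sigma> (int \<circ> \<beta>) * \<theta> (int \<circ> \<alpha>) - \<sigma> (int \<circ> \<alpha>) * \<theta> (int \<circ> \<beta>)" for \<beta>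
  have lat: "int \<circ> \<beta> \<in> int_lattice Q" if "\<beta> \<in> dim_vectors Q" for \<beta>
    using that by (auto simp: dim_vectors_def int_lattice_def)
  have plus: "int \<circ> (\<beta> + \<gamma>) = (int \<circ> \<beta>) + (int \<circ> \<gamma>)" for \<beta> \<gamma> :: "'v \<Rightarrow> nat" by auto
  have sign: "\<mu> \<beta> < \<mu> \<alpha> \<longleftrightarrow> f \<beta> < 0" "\<mu> \<alpha> < \<mu> \<beta> \<longleftrightarrow> 0 < f \<beta>"
    if \<beta>: "\<beta> \<in> dim_vectors Q" "\<beta> \<noteq> 0" for \<beta>
  proof -
    have p: "0 < (of_int (\<theta> (int \<circ> \<alpha>)) :: rat)" "0 < (of_int (\<theta> (int \<circ> \<beta>)) :: rat)"
      using pos assms \<beta> by simp_all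
    show "\<mu> \<beta> < \<mu> \<alpha> \<longleftrightarrow> f \<beta> < 0" "\<mu> \<alpha> < \<mu> \<beta> \<longleftrightarrow> 0 < f \<beta>"
      unfolding \<mu>[OF \<beta>] \<mu>[OF assms(2,3)] f_def
      using p by (simp_all add: field_simps flip: of_int_mult)
  qed
  show thesis
    by (rule that[of f]) (use w lat sign in \<open>auto simp: f_def plus weight_def algebra_simps\<close>)
qed

text \<open>
  The total dimension of every summand is at least 1, which bounds both the number of
  summands and their entries by the total dimension of \<open>\<alpha>\<close>.
\<close>

lemma finite_decompositions:
  assumes "fin_digraph Q"
  shows "finite (decompositions Q \<mu> \<alpha>)"
proof -
  interpret fin_digraph Q by fact
  define size where "size \<beta> = (\<Sum>v\<in>verts Q. \<beta> v)" for \<beta> :: "'a \<Rightarrow> nat"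
  have size_sum_list: "size (sum_list \<alpha>s) = sum_list (map size \<alpha>s)" for \<alpha>s
    by (induction \<alpha>s) (auto simp: size_def sum.distrib)
  have size_pos: "size \<beta> \<ge> 1" if "\<beta> \<in> dim_vectors Q - {0}" for \<beta>
  proof -
    obtain v where "\<beta> v \<noteq> 0" using \<open>\<beta> \<in> dim_vectors Q - {0}\<close> by (auto simp: fun_eq_iff)
    moreover from this have "v \<in> verts Q" using that by (auto simp: dim_vectors_def)
    ultimately have "size \<beta> \<noteq> 0" by (auto simp: size_def)
    then show ?thesis by simp
  qed
  let ?B = "{\<beta>. \<forall>v. (v \<in> verts Q \<longrightarrow> \<beta> v \<in> {..size \<alpha>}) \<and> (v \<notin> verts Q \<longrightarrow> \<beta> v = 0)}"
  have "decompositions Q \<mu> \<alpha> \<subseteq> {\<alpha>s. set \<alpha>s \<subseteq> ?B \<and> length \<alpha>s \<le> size \<alpha>}"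
  proof
    fix \<alpha>s assume "\<alpha>s \<in> decompositions Q \<mu> \<alpha>"
    then have \<alpha>s: "set \<alpha>s \<subseteq> dim_vectors Q - {0}" "sum_list \<alpha>s = \<alpha>"
      by (auto simp: decompositions_def)
    have "\<beta> \<in> ?B" if "\<beta> \<in> set \<alpha>s" for \<beta>
    proof -
      have "size \<beta> \<le> size \<alpha>"
        using member_le_sum_list[of "size \<beta>" "map size \<alpha>s"] that \<alpha>s(2) size_sum_list[of \<alpha>s] by simp
      then have "\<beta> v \<le> size \<alpha>" if "v \<in> verts Q" for v
        using member_le_sum[of v "verts Q" \<beta>] that by (simp add: size_def)
      then show ?thesis using \<alpha>s(1) that by (auto simp: dim_vectors_def)
    qed
    moreover have "length \<alpha>s \<le> sum_list (map size \<alpha>s)"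
      using \<alpha>s(1)
    proof (induction \<alpha>s)
      case (Cons \<beta> \<alpha>s)
      moreover have "size \<beta> \<ge> 1" using Cons.prems by (intro size_pos) (metis list.set_intros(1) subsetD)
      ultimately show ?case by auto
    qed simp
    ultimately show "\<alpha>s \<in> {\<alpha>s. set \<alpha>s \<subseteq> ?B \<and> length \<alpha>s \<le> size \<alpha>}"
      using size_sum_list[of \<alpha>s] \<alpha>s(2) by auto
  qed
  moreover have "finite ?B" by (rule finite_set_of_finite_funs) auto
  ultimately show ?thesis using finite_lists_length_le finite_subset by blast
qed

lemma sum_list_dim_vectors: "set \<alpha>s \<subseteq> dim_vectors Q \<Longrightarrow> sum_list \<alpha>s \<in> dim_vectors Q"
  by (induction \<alpha>s) (auto simp: dim_vectors_def)

section \<open>Flags as chains of destabilizing subrepresentations\<close>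

definition complete_flag ::
  "('v, 'e) pre_digraph \<Rightarrow> ('v \<Rightarrow> nat) \<Rightarrow> ('v \<Rightarrow> 'k::field vec set) list \<Rightarrow> ('v \<Rightarrow> 'k vec set) list" where
  "complete_flag Q \<alpha> Ls = zero_subrep Q \<alpha> # Ls @ [full_subrep Q \<alpha>]"

definition flags_of_type ::
  "('v, 'e) pre_digraph \<Rightarrow> ('v \<Rightarrow> nat) \<Rightarrow> ('e \<Rightarrow> 'k::field mat) \<Rightarrow> ('v \<Rightarrow> nat) list
    \<Rightarrow> ('v \<Rightarrow> 'k vec set) list set" where
  "flags_of_type Q \<alpha> M \<alpha>s = {Ls. length Ls = length \<alpha>s - 1 \<and> set Ls \<subseteq> subreps Q \<alpha> M \<and>
     (let F = complete_flag Q \<alpha> Ls in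
       \<forall>i\<in>{1..length \<alpha>s}. (\<forall>v\<in>verts Q. (F ! (i - 1)) v \<subseteq> (F ! i) v) \<and>
         dim_vector Q \<alpha> (F ! i) = dim_vector Q \<alpha> (F ! (i - 1)) + \<alpha>s ! (length \<alpha>s - i))}"

text \<open>
  The successive differences of the dimension vectors of a flag, from the top quotient down to the
  smallest subrepresentation, which is the order of the list \<open>\<alpha>s\<close>.
\<close>

definition flag_type ::
  "('v, 'e) pre_digraph \<Rightarrow> ('v \<Rightarrow> nat) \<Rightarrow> ('v \<Rightarrow> 'k::field vec set) list \<Rightarrow> ('v \<Rightarrow> nat) list" where
  "flag_type Q \<alpha> Ls = (let F = complete_flag Q \<alpha> Ls; s = Suc (length Ls) in
     map (\<lambda>l. dim_vector Q \<alpha> (F ! (s - l)) - dim_vector Q \<alpha> (F ! (s - Suc l))) [0..<s])"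

lemma Frep_eq_Sigma:
  "Frep Q I \<alpha>s = (SIGMA M:Rep Q I (sum_list \<alpha>s). flags_of_type Q (sum_list \<alpha>s) M \<alpha>s)"
  unfolding Frep_def flags_of_type_def complete_flag_def Let_def Sigma_def by blast

context quiver_rep
begin

abbreviation "flag \<equiv> complete_flag Q \<alpha>"
abbreviation "flags \<equiv> flags_of_type Q \<alpha> M"

lemmas flag_def = complete_flag_def[of Q \<alpha>]
lemmas flags_def = flags_of_type_def[of Q \<alpha> M, unfolded Let_def]

text \<open>
  Since a flag determines its type, the flags of different types form disjoint sets.
\<close>

lemma flags_type:
  assumes "Ls \<in> flags \<alpha>s" "\<alpha>s \<noteq> []"
  shows "\<alpha>s = flag_type Q \<alpha> Ls"
proof (rule nth_equalityI)
  have len: "length \<alpha>s = Suc (length Ls)" using assms by (cases \<alpha>s) (auto simp: flags_def)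
  then show "length \<alpha>s = length (flag_type Q \<alpha> Ls)" by (simp add: flag_type_def Let_def)
  fix l assume l: "l < length \<alpha>s"
  then have "length \<alpha>s - l \<in> {1..length \<alpha>s}" by auto
  then have "dimv (flag Ls ! (length \<alpha>s - l)) = dimv (flag Ls ! (length \<alpha>s - l - 1)) +
      \<alpha>s ! (length \<alpha>s - (length \<alpha>s - l))"
    using assms(1) unfolding flags_def by blast
  moreover have "length \<alpha>s - (length \<alpha>s - l) = l" "length \<alpha>s - l - 1 = length Ls - l"
    using l len by auto
  ultimately have "dimv (flag Ls ! (Suc (length Ls) - l)) = dimv (flag Ls ! (length Ls - l)) + \<alpha>s ! l"
    using len by simp
  then show "\<alpha>s ! l = flag_type Q \<alpha> Ls ! l"
    using l len by (simp add: flag_type_def Let_def fun_eq_iff del: upt_Suc)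
qed

text \<open>
  The partial sum \<open>\<alpha>\<^sub>1 + \<dots> + \<alpha>\<^sub>j\<close> is the dimension vector of the quotient of
  \<open>M\<close> by the term \<open>j\<close> steps below \<open>M\<close> in the flag; this translates the slope conditions on
  the decomposition into conditions on the terms of the flag.
\<close>

lemma sum_list_take_flags:
  assumes Ls: "Ls \<in> flags \<alpha>s" and "\<alpha>s \<noteq> []" and "\<alpha> \<in> dim_vectors Q" and "j \<le> length \<alpha>s"
  shows "sum_list (take j \<alpha>s) + dimv (flag Ls ! (length \<alpha>s - j)) = \<alpha>"
  using \<open>j \<le> length \<alpha>s\<close>
proof (induction j)
  case 0
  have "length \<alpha>s = Suc (length Ls)" using assms by (cases \<alpha>s) (auto simp: flags_def)
  then show ?case by (simp add: flag_def nth_append dimv_full[OF assms(3)])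
next
  case (Suc j)
  then have "length \<alpha>s - j \<in> {1..length \<alpha>s}" by auto
  then have "dimv (flag Ls ! (length \<alpha>s - j)) = dimv (flag Ls ! (length \<alpha>s - j - 1)) +
      \<alpha>s ! (length \<alpha>s - (length \<alpha>s - j))"
    using Ls unfolding flags_def by blast
  moreover have "length \<alpha>s - (length \<alpha>s - j) = j" "length \<alpha>s - j - 1 = length \<alpha>s - Suc j"
    using Suc by auto
  ultimately show ?case
    using Suc by (simp add: take_Suc_conv_app_nth add_ac)
qed

text \<open>
  Since \<open>f\<close> is additive and vanishes at \<open>\<alpha>\<close>, the quotient by \<open>L\<close> has negative value exactly when
  \<open>L\<close> has positive value. So the slope conditions on a decomposition say that all proper
  terms of the flag are positive. Conversely, a strict chain of positive subrepresentations can be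
  completed by the zero and the full subrepresentation, because \<open>f\<close> vanishes at both, and its
  type then consists of nonzero dimension vectors.
\<close>

lemma decompositions_flags_iff_chain:
  fixes f :: "('v \<Rightarrow> nat) \<Rightarrow> int"
  assumes \<alpha>: "\<alpha> \<in> dim_vectors Q" "\<alpha> \<noteq> 0"
    and add: "\<And>\<beta> \<gamma>. \<beta> \<in> dim_vectors Q \<Longrightarrow> \<gamma> \<in> dim_vectors Q \<Longrightarrow> f (\<beta> + \<gamma>) = f \<beta> + f \<gamma>"
    and f_\<alpha>: "f \<alpha> = 0"
    and less: "\<And>\<beta>. \<beta> \<in> dim_vectors Q \<Longrightarrow> \<beta> \<noteq> 0 \<Longrightarrow> \<mu> \<beta> < \<mu> \<alpha> \<longleftrightarrow> f \<beta> < 0"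
  shows "(\<alpha>s \<in> decompositions Q \<mu> \<alpha> \<and> Ls \<in> flags \<alpha>s) \<longleftrightarrow>
    \<alpha>s = flag_type Q \<alpha> Ls \<and> set Ls \<subseteq> {L \<in> sub. f (dimv L) > 0} \<and> sorted_wrt (<) Ls"
proof (intro iffI conjI; (elim conjE)?)
  assume dec: "\<alpha>s \<in> decompositions Q \<mu> \<alpha>" and Ls: "Ls \<in> flags \<alpha>s"
  then have ne: "\<alpha>s \<noteq> []" and \<alpha>s: "set \<alpha>s \<subseteq> dim_vectors Q - {0}"
    by (auto simp: decompositions_def)
  show "\<alpha>s = flag_type Q \<alpha> Ls" by (rule flags_type[OF Ls ne])
  have len: "length \<alpha>s = Suc (length Ls)" using Ls ne by (cases \<alpha>s) (auto simp: flags_def)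
  have Ls_sub: "set Ls \<subseteq> sub" using Ls by (simp add: flags_def)
  have nth_flag: "flag Ls ! Suc k = Ls ! k" if "k < length Ls" for k
    using that by (simp add: flag_def nth_append)
  have "f (dimv (Ls ! k)) > 0" if k: "k < length Ls" for k
  proof -
    define j where "j = length Ls - k"
    have j: "1 \<le> j" "j < length \<alpha>s" "length \<alpha>s - j = Suc k" using k len by (auto simp: j_def)
    let ?\<beta> = "sum_list (take j \<alpha>s)"
    have sum: "?\<beta> + dimv (Ls ! k) = \<alpha>"
      using sum_list_take_flags[OF Ls ne \<alpha>(1), of j] j nth_flag[OF k] by simp
    have take: "set (take j \<alpha>s) \<subseteq> dim_vectors Q - {0}" using \<alpha>s set_take_subset by fast
    then have "?\<beta> \<in> dim_vectors Q" by (intro sum_list_dim_vectors) auto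
    moreover have "?\<beta> \<noteq> 0"
    proof -
      obtain \<gamma> \<gamma>s where "take j \<alpha>s = \<gamma> # \<gamma>s" using j ne by (cases "take j \<alpha>s") auto
      moreover from this obtain v where "\<gamma> v \<noteq> 0" using take by (auto simp: fun_eq_iff)
      ultimately show ?thesis by (auto simp: fun_eq_iff)
    qed
    moreover have "\<mu> ?\<beta> < \<mu> \<alpha>" using dec j by (simp add: decompositions_def)
    ultimately have "f ?\<beta> < 0" using less by blast
    moreover have "f ?\<beta> + f (dimv (Ls ! k)) = 0"
      using add[OF \<open>?\<beta> \<in> dim_vectors Q\<close> dimv_in_dim_vectors] sum f_\<alpha> by metis
    ultimately show ?thesis by simp
  qed
  then show "set Ls \<subseteq> {L \<in> sub. f (dimv L) > 0}"
    using Ls_sub by (auto simp: in_set_conv_nth)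
  have "Ls ! k < Ls ! Suc k" if k: "Suc k < length Ls" for k
  proof -
    have "Suc (Suc k) \<in> {1..length \<alpha>s}" using k len by auto
    then have "(\<forall>v\<in>verts Q. (flag Ls ! Suc k) v \<subseteq> (flag Ls ! Suc (Suc k)) v) \<and>
        dimv (flag Ls ! Suc (Suc k)) =
          dimv (flag Ls ! Suc k) + \<alpha>s ! (length \<alpha>s - Suc (Suc k))"
      using Ls unfolding flags_def by fastforce
    then have *: "\<forall>v\<in>verts Q. (Ls ! k) v \<subseteq> (Ls ! Suc k) v"
      "dimv (Ls ! Suc k) = dimv (Ls ! k) + \<alpha>s ! (length \<alpha>s - Suc (Suc k))"
      using nth_flag[of k] nth_flag[of "Suc k"] k by simp_all
    have "Ls ! k \<in> sub" "Ls ! Suc k \<in> sub" using Ls_sub k by (auto intro: nth_mem)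
    then have "Ls ! k \<le> Ls ! Suc k" using subrep_le_iff *(1) by blast
    moreover have "\<alpha>s ! (length \<alpha>s - Suc (Suc k)) \<noteq> 0" using \<alpha>s k len by (auto simp: subset_iff)
    then have "Ls ! k \<noteq> Ls ! Suc k" using *(2) by auto
    ultimately show ?thesis by simp
  qed
  then show "sorted_wrt (<) Ls" by (simp add: sorted_wrt_iff_nth_Suc_transp)
next
  assume \<alpha>s: "\<alpha>s = flag_type Q \<alpha> Ls" and D: "set Ls \<subseteq> {L \<in> sub. f (dimv L) > 0}"
    and sorted: "sorted_wrt (<) Ls"
  have len: "length \<alpha>s = Suc (length Ls)" by (simp add: \<alpha>s flag_type_def Let_def)
  then have ne: "\<alpha>s \<noteq> []" by auto
  have f_0: "f 0 = 0" using add[of 0 0] by (simp add: dim_vectors_def)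
  have "zero_subrep Q \<alpha> < L" "L < full_subrep Q \<alpha>" if "L \<in> set Ls" for L
    using that D zero_subrep_le[of L] le_full_subrep[of L] f_0 f_\<alpha> dimv_zero dimv_full[OF \<alpha>(1)]
    by (auto simp: order_less_le)
  moreover have "zero_subrep Q \<alpha> < (full_subrep Q \<alpha> :: 'v \<Rightarrow> 'k vec set)"
    using zero_subrep_le[OF full_subrep_in] \<alpha>(2) dimv_zero dimv_full[OF \<alpha>(1)]
    by (metis order_less_le)
  ultimately have "sorted_wrt (<) (flag Ls)"
    using sorted by (auto simp: flag_def sorted_wrt_append)
  then have strict: "flag Ls ! (i - 1) < flag Ls ! i" if "i \<in> {1..length \<alpha>s}" for i
    using that len by (intro sorted_wrt_nth_less[OF \<open>sorted_wrt (<) (flag Ls)\<close>]) (auto simp: flag_def)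
  have flag_sub: "flag Ls ! i \<in> sub" if "i \<le> length \<alpha>s" for i
  proof -
    have "set (flag Ls) \<subseteq> sub" using D zero_subrep_in full_subrep_in by (auto simp: flag_def)
    then show ?thesis using that len nth_mem[of i "flag Ls"] by (auto simp: flag_def)
  qed
  have dim_less: "dimv (flag Ls ! (i - 1)) < dimv (flag Ls ! i)" if "i \<in> {1..length \<alpha>s}" for i
    using that by (intro dimv_strict_mono strict flag_sub) auto
  have nth_\<alpha>s: "\<alpha>s ! (length \<alpha>s - i) = dimv (flag Ls ! i) - dimv (flag Ls ! (i - 1))"
    if "i \<in> {1..length \<alpha>s}" for i
    using that len by (auto simp: \<alpha>s flag_type_def Let_def simp del: upt_Suc)
  have "dimv (flag Ls ! i) = dimv (flag Ls ! (i - 1)) + \<alpha>s ! (length \<alpha>s - i)"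
    if "i \<in> {1..length \<alpha>s}" for i
    using le_funD[OF less_imp_le[OF dim_less[OF that]]] unfolding nth_\<alpha>s[OF that]
    by (auto simp: fun_eq_iff)
  moreover have "(flag Ls ! (i - 1)) v \<subseteq> (flag Ls ! i) v" if "i \<in> {1..length \<alpha>s}" for i v
    using le_funD[OF less_imp_le[OF strict[OF that]]] .
  ultimately show Ls: "Ls \<in> flags \<alpha>s"
    using D len unfolding flags_def by (intro CollectI conjI ballI) auto
  have entries: "set \<alpha>s \<subseteq> dim_vectors Q - {0}"
  proof
    fix \<beta> assume "\<beta> \<in> set \<alpha>s"
    then obtain l where l: "l < length \<alpha>s" "\<beta> = \<alpha>s ! l" by (auto simp: in_set_conv_nth)
    define i where "i = length \<alpha>s - l"
    have i: "i \<in> {1..length \<alpha>s}" "l = length \<alpha>s - i" using l by (auto simp: i_def)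
    have "\<beta> = dimv (flag Ls ! i) - dimv (flag Ls ! (i - 1))" using l i nth_\<alpha>s by simp
    moreover have "\<beta> \<noteq> 0"
    proof
      assume "\<beta> = 0"
      then have "dimv (flag Ls ! i) \<le> dimv (flag Ls ! (i - 1))"
        using \<open>\<beta> = dimv (flag Ls ! i) - dimv (flag Ls ! (i - 1))\<close>
        by (auto simp: fun_eq_iff le_fun_def)
      then show False using dim_less[OF i(1)] by simp
    qed
    ultimately show "\<beta> \<in> dim_vectors Q - {0}"
      by (auto simp: dim_vector_def dim_vectors_def)
  qed
  have "sum_list \<alpha>s = \<alpha>"
    using sum_list_take_flags[OF Ls ne \<alpha>(1), of "length \<alpha>s"] by (simp add: flag_def dimv_zero)
  moreover have "\<mu> (sum_list (take j \<alpha>s)) < \<mu> \<alpha>" if j: "1 \<le> j" "j < length \<alpha>s" for j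
  proof -
    let ?\<beta> = "sum_list (take j \<alpha>s)"
    have \<beta>: "?\<beta> \<in> dim_vectors Q"
      using entries set_take_subset by (intro sum_list_dim_vectors) fast
    let ?L = "flag Ls ! (length \<alpha>s - j)"
    have "?L = Ls ! (length Ls - j)"
      using j len by (auto simp: flag_def Suc_diff_le nth_append)
    then have "?L \<in> set Ls" using j len by simp
    then have "f (dimv ?L) > 0" using D by auto
    have "?\<beta> + dimv ?L = \<alpha>"
      by (rule sum_list_take_flags[OF Ls ne \<alpha>(1)]) (use j in simp)
    then have "f ?\<beta> + f (dimv ?L) = 0"
      using add[OF \<beta> dimv_in_dim_vectors[of ?L]] f_\<alpha> by simp
    moreover note \<open>f (dimv ?L) > 0\<close>
    ultimately have "f ?\<beta> < 0" by simp
    then show ?thesis using less[OF \<beta>] f_0 by (metis less_irrefl)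
  qed
  ultimately show "\<alpha>s \<in> decompositions Q \<mu> \<alpha>"
    using entries ne by (auto simp: decompositions_def)
qed

end

section \<open>The counting formula\<close>

theorem lemma0p1:
  fixes Q :: "('v, 'e) pre_digraph"
    and I :: "(('v, 'e) path \<Rightarrow>\<^sub>0 'k::{field, finite}) set"
    and \<mu> :: "('v \<Rightarrow> nat) \<Rightarrow> rat"
    and \<alpha> :: "'v \<Rightarrow> nat"
  assumes "fin_digraph Q"
    and "ideal I (path_algebra Q)"
    and "slope_function Q \<mu>"
    and "\<alpha> \<in> dim_vectors Q" and "\<alpha> \<noteq> 0"
  shows "int (card (Rep_semistable Q I \<mu> \<alpha>)) =
    (\<Sum>\<alpha>s\<in>decompositions Q \<mu> \<alpha>. (-1) ^ (length \<alpha>s - 1) * int (card (Frep Q I \<alpha>s)))"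
proof -
  interpret fin_digraph Q by fact
  obtain f :: "('v \<Rightarrow> nat) \<Rightarrow> int" where
    add: "\<And>\<beta> \<gamma>. \<beta> \<in> dim_vectors Q \<Longrightarrow> \<gamma> \<in> dim_vectors Q \<Longrightarrow> f (\<beta> + \<gamma>) = f \<beta> + f \<gamma>"
    and f_\<alpha>: "f \<alpha> = 0"
    and less: "\<And>\<beta>. \<beta> \<in> dim_vectors Q \<Longrightarrow> \<beta> \<noteq> 0 \<Longrightarrow> \<mu> \<beta> < \<mu> \<alpha> \<longleftrightarrow> f \<beta> < 0"
    and greater: "\<And>\<beta>. \<beta> \<in> dim_vectors Q \<Longrightarrow> \<beta> \<noteq> 0 \<Longrightarrow> \<mu> \<alpha> < \<mu> \<beta> \<longleftrightarrow> 0 < f \<beta>"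
    using slope_function_sign assms(3-5) by blast
  have f_0: "f 0 = 0" using add[of 0 0] by (simp add: dim_vectors_def)
  have rep: "quiver_rep Q \<alpha> M" if "M \<in> Rep Q I \<alpha>" for M :: "'e \<Rightarrow> 'k mat"
    using that by unfold_locales (simp add: Rep_def)
  have fin_Rep: "finite (Rep Q I \<alpha>)"
  proof (rule finite_subset)
    show "Rep Q I \<alpha> \<subseteq> Rep_quiver Q \<alpha>" by (auto simp: Rep_def)
    show "finite (Rep_quiver Q \<alpha> :: ('e \<Rightarrow> 'k mat) set)"
      unfolding Rep_quiver_def by (intro finite_PiE finite_carrier_mat) auto
  qed
  let ?D = "\<lambda>M. {L \<in> subreps Q \<alpha> M. f (dim_vector Q \<alpha> L) > 0}"
  let ?C = "\<lambda>M. {c. set c \<subseteq> ?D M \<and> sorted_wrt (<) c}"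
  let ?F = "\<lambda>\<alpha>s M. flags_of_type Q \<alpha> M \<alpha>s"
  (* The zero subrepresentation is harmless: f vanishes there, and every other one has a nonzero
     dimension vector, so that its slope is governed by the sign of f. *)
  have semistable: "semistable Q \<mu> \<alpha> M \<longleftrightarrow> ?D M = {}" if "M \<in> Rep Q I \<alpha>" for M
  proof -
    interpret quiver_rep Q \<alpha> M by (rule rep[OF that])
    have "dim_vector Q \<alpha> L \<noteq> 0" if "L \<in> sub" "L \<noteq> zero_subrep Q \<alpha>" for L
      using dimv_strict_mono[OF zero_subrep_in that(1)] zero_subrep_le[OF that(1)] that(2)
      by (metis dimv_zero order_less_le)
    then have "\<mu> (dimv L) \<le> \<mu> \<alpha> \<longleftrightarrow> \<not> f (dimv L) > 0" if "L \<in> sub" "L \<noteq> zero_subrep Q \<alpha>" for L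
      using greater[OF dimv_in_dim_vectors, of L] that by (metis not_le)
    moreover have "\<not> f (dimv (zero_subrep Q \<alpha> :: 'v \<Rightarrow> 'k vec set)) > 0"
      by (simp add: dimv_zero f_0)
    ultimately show ?thesis unfolding semistable_def by auto
  qed
  have flags_iff: "(\<alpha>s \<in> decompositions Q \<mu> \<alpha> \<and> Ls \<in> ?F \<alpha>s M) \<longleftrightarrow>
      \<alpha>s = flag_type Q \<alpha> Ls \<and> Ls \<in> ?C M"
    if "M \<in> Rep Q I \<alpha>" for M \<alpha>s Ls
  proof -
    interpret quiver_rep Q \<alpha> M by (rule rep[OF that])
    show ?thesis
      unfolding mem_Collect_eq
      by (rule decompositions_flags_iff_chain[OF assms(4,5)]) (use add f_\<alpha> less in blast)+
  qed
  have fin_C: "finite (?C M)" if "M \<in> Rep Q I \<alpha>" for M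
    by (rule finite_chains, rule finite_subset[OF _ quiver_rep.finite_subreps[OF rep[OF that]]]) auto
  have fin_F: "finite (?F \<alpha>s M)" if "M \<in> Rep Q I \<alpha>" "\<alpha>s \<in> decompositions Q \<mu> \<alpha>" for M \<alpha>s
    using flags_iff[OF that(1)] that(2) by (intro finite_subset[OF _ fin_C[OF that(1)]]) blast
  have card_Frep: "card (Frep Q I \<alpha>s) = (\<Sum>M\<in>Rep Q I \<alpha>. card (?F \<alpha>s M))"
    if "\<alpha>s \<in> decompositions Q \<mu> \<alpha>" for \<alpha>s
  proof -
    have "sum_list \<alpha>s = \<alpha>" using that by (simp add: decompositions_def)
    then have "Frep Q I \<alpha>s = (SIGMA M:Rep Q I \<alpha>. ?F \<alpha>s M)"
      by (simp add: Frep_eq_Sigma)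
    then show ?thesis using fin_Rep fin_F[OF _ that] by simp
  qed
  (* Exchanging the summations leaves, for each M, the alternating sum over its destabilizing chains. *)
  have "(\<Sum>\<alpha>s\<in>decompositions Q \<mu> \<alpha>. (-1) ^ (length \<alpha>s - 1) * int (card (Frep Q I \<alpha>s)))
    = (\<Sum>\<alpha>s\<in>decompositions Q \<mu> \<alpha>. \<Sum>M\<in>Rep Q I \<alpha>. (-1) ^ (length \<alpha>s - 1) * int (card (?F \<alpha>s M)))"
    by (simp add: card_Frep sum_distrib_left)
  also have "\<dots> = (\<Sum>M\<in>Rep Q I \<alpha>. \<Sum>\<alpha>s\<in>decompositions Q \<mu> \<alpha>. (-1) ^ (length \<alpha>s - 1) * int (card (?F \<alpha>s M)))"
    by (rule sum.swap)
  also have "\<dots> = (\<Sum>M\<in>Rep Q I \<alpha>. if ?D M = {} then 1 else 0)"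
  proof (rule sum.cong[OF refl])
    fix M assume M: "M \<in> Rep Q I \<alpha>"
    interpret quiver_rep Q \<alpha> M by (rule rep[OF M])
    have "(\<Sum>\<alpha>s\<in>decompositions Q \<mu> \<alpha>. (-1) ^ (length \<alpha>s - 1) * int (card (?F \<alpha>s M)))
      = (\<Sum>\<alpha>s\<in>decompositions Q \<mu> \<alpha>. \<Sum>Ls\<in>flags \<alpha>s. (-1) ^ length Ls)"
      by (intro sum.cong refl) (simp add: flags_def)
    also have "\<dots> = (\<Sum>(\<alpha>s, Ls)\<in>Sigma (decompositions Q \<mu> \<alpha>) flags. (-1) ^ length Ls)"
      using fin_F[OF M] by (intro sum.Sigma finite_decompositions assms(1)) auto
    also have "\<dots> = (\<Sum>c\<in>?C M. (-1) ^ length c)"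
    proof (rule sum.reindex_bij_witness[of _ "\<lambda>c. (flag_type Q \<alpha> c, c)" snd])
      fix p assume "p \<in> Sigma (decompositions Q \<mu> \<alpha>) flags"
      then have "fst p \<in> decompositions Q \<mu> \<alpha> \<and> snd p \<in> flags (fst p)" by auto
      then have *: "fst p = flag_type Q \<alpha> (snd p) \<and> snd p \<in> ?C M"
        by (rule iffD1[OF flags_iff[OF M]])
      then show "(flag_type Q \<alpha> (snd p), snd p) = p" by (simp add: prod_eq_iff)
      show "snd p \<in> ?C M" using * by blast
      show "(-1) ^ length (snd p) = (case p of (\<alpha>s, Ls) \<Rightarrow> (-1 :: int) ^ length Ls)"
        by (simp add: split_def)
    next
      fix c assume c: "c \<in> ?C M"
      have "flag_type Q \<alpha> c \<in> decompositions Q \<mu> \<alpha> \<and> c \<in> flags (flag_type Q \<alpha> c)"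
        by (rule iffD2[OF flags_iff[OF M]]) (intro conjI refl c)
      then show "(flag_type Q \<alpha> c, c) \<in> Sigma (decompositions Q \<mu> \<alpha>) flags" by simp
    qed simp
    also have "\<dots> = (if ?D M = {} then 1 else 0)"
      by (rule sum_destabilizing_chains) (rule add)
    finally show "(\<Sum>\<alpha>s\<in>decompositions Q \<mu> \<alpha>. (-1) ^ (length \<alpha>s - 1) * int (card (?F \<alpha>s M)))
      = (if ?D M = {} then 1 else 0)" .
  qed
  also have "\<dots> = int (card {M \<in> Rep Q I \<alpha>. ?D M = {}})"
    using sum.inter_filter[OF fin_Rep, of "\<lambda>_. 1 :: int" "\<lambda>M. ?D M = {}"] by simp
  also have "{M \<in> Rep Q I \<alpha>. ?D M = {}} = Rep_semistable Q I \<mu> \<alpha>"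
    using semistable by (auto simp: Rep_semistable_def)
  finally show ?thesis by simp
qed

end
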